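(* Every $(2K_2,K_4,H_4)$-free graph that contains an induced $W_5$ is recolorable.
   Context: All graphs are finite and simple. For graphs $F_1,\dots,F_t$, a graph $G$ is $(F_1,\dots,F_t)$-free if no induced subgraph of $G$ is isomorphic to any $F_j$. $2K_2$ is the disjoint union of two copies of $K_2$, and $K_4$ is the complete graph on four vertices. $W_5$ is the graph on six vertices obtained from a $5$-cycle by adding one new vertex adjacent to all five cycle vertices. $H_4$ is the graph on six vertices obtained from a $5$-cycle by adding one new vertex adjacent to exactly four of the cycle vertices. An $\ell$-coloring of $G$ is a map $V(G)\to\{1,\dots,\ell\}$ giving adjacent vertices distinct colors (not all colors need be used); $\chi(G)$ is the least $\ell$ for which an $\ell$-coloring exists. The reconfiguration graph $\mathcal{R}_\ell(G)$ has the $\ell$-colorings of $G$ as vertices, with two colorings adjacent whenever they differ on exactly one vertex of $G$. The graph $G$ is recolorable if $\mathcal{R}_\ell(G)$ is connected for every $\ell>\chi(G)$. *)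

theory Defs
  imports "Graph_Theory.Graph_Theory" "HOL-Library.FuncSet"
begin

text \<open>
  A finite simple graph is a \<^locale>\<open>graph\<close>, i.e. a finite symmetric digraph without loops and
  parallel arcs. Each undirected edge is thus represented by two opposite arcs.
\<close>

definition graph_on :: "nat \<Rightarrow> nat rel \<Rightarrow> (nat, nat \<times> nat) pre_digraph" where
  "graph_on n E = with_proj \<lparr> pverts = {..<n}, parcs = symcl E \<rparr>"

definition cycle5_edges :: "nat rel" where
  "cycle5_edges = {(0,1), (1,2), (2,3), (3,4), (4,0)}"

definition two_K2 :: "(nat, nat \<times> nat) pre_digraph" where
  "two_K2 = graph_on 4 {(0,1), (2,3)}"

definition K4 :: "(nat, nat \<times> nat) pre_digraph" where
  "K4 = graph_on 4 {(0,1), (0,2), (0,3), (1,2), (1,3), (2,3)}"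

definition W5 :: "(nat, nat \<times> nat) pre_digraph" where
  "W5 = graph_on 6 (cycle5_edges \<union> {(5,0), (5,1), (5,2), (5,3), (5,4)})"

definition H4 :: "(nat, nat \<times> nat) pre_digraph" where
  "H4 = graph_on 6 (cycle5_edges \<union> {(5,0), (5,1), (5,2), (5,3)})"

definition contains_induced :: "('a,'b) pre_digraph \<Rightarrow> ('c,'d) pre_digraph \<Rightarrow> bool" where
  "contains_induced G F \<longleftrightarrow> (\<exists>H. induced_subgraph H G \<and> digraph_iso H F)"

definition free_of :: "('c,'d) pre_digraph list \<Rightarrow> ('a,'b) pre_digraph \<Rightarrow> bool" where
  "free_of Fs G \<longleftrightarrow> (\<forall>F \<in> set Fs. \<not> contains_induced G F)"

text \<open>
  Colorings are extensional functions (undefined outside the vertex set), so that equality of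
  colorings is equality of functions on the vertex set.
\<close>

definition colorings :: "('a,'b) pre_digraph \<Rightarrow> nat \<Rightarrow> ('a \<Rightarrow> nat) set" where
  "colorings G l = {c \<in> verts G \<rightarrow>\<^sub>E {1..l}. \<forall>u v. u \<rightarrow>\<^bsub>G\<^esub> v \<longrightarrow> c u \<noteq> c v}"

definition chromatic_number :: "('a,'b) pre_digraph \<Rightarrow> nat" where
  "chromatic_number G = (LEAST l. colorings G l \<noteq> {})"

definition reconfiguration_graph ::
  "nat \<Rightarrow> ('a,'b) pre_digraph \<Rightarrow> ('a \<Rightarrow> nat, ('a \<Rightarrow> nat) \<times> ('a \<Rightarrow> nat)) pre_digraph" where
  "reconfiguration_graph l G = with_proj \<lparr>
     pverts = colorings G l,
     parcs = {(c, d). c \<in> colorings G l \<and> d \<in> colorings G l \<and> (\<exists>!v. v \<in> verts G \<and> c v \<noteq> d v)} \<rparr>"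

definition recolorable :: "('a,'b) pre_digraph \<Rightarrow> bool" where
  "recolorable G \<longleftrightarrow>
     (\<forall>l > chromatic_number G. Digraph_Component.connected (reconfiguration_graph l G))"

lemma graph_graph_on:
  assumes "E \<subseteq> {..<n} \<times> {..<n}" "irrefl E"
  shows "graph (graph_on n E)"
proof -
  have "finite E" using assms(1) by (rule finite_subset) simp
  then interpret pair_graph "\<lparr> pverts = {..<n}, parcs = symcl E \<rparr>"
    using assms by unfold_locales (auto simp: symcl_def irrefl_def symmetric_def sym_def)
  show ?thesis unfolding graph_on_def by unfold_locales
qed

lemma graph_small_graphs: "graph two_K2" "graph K4" "graph W5" "graph H4"
  unfolding two_K2_def K4_def W5_def H4_def
  by (rule graph_graph_on; auto simp: irrefl_def cycle5_edges_def)+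

lemma complete_digraph_K4: "complete_digraph 4 K4"
proof -
  have *: "{..<4::nat} = {0,1,2,3}" by auto
  have "arcs_ends K4 = {(u,v). (u,v) \<in> {..<4} \<times> {..<4} \<and> u \<noteq> v}"
    unfolding K4_def graph_on_def with_proj_simps pair_pre_digraph.simps symcl_def * by force
  then show ?thesis
    using graph_small_graphs(2) unfolding complete_digraph_def
    by (simp add: K4_def graph_on_def)
qed

lemma graph_reconfiguration_graph:
  assumes "graph G"
  shows "graph (reconfiguration_graph l G)"
proof -
  interpret graph G by fact
  have "colorings G l \<subseteq> verts G \<rightarrow>\<^sub>E {1..l}" by (auto simp: colorings_def)
  then have fin: "finite (colorings G l)"
    by (rule finite_subset) (intro finite_PiE; simp)
  have fin': "finite {(c, d). c \<in> colorings G l \<and> d \<in> colorings G l \<and> P c d}" for P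
    by (rule finite_subset[of _ "colorings G l \<times> colorings G l"]) (use fin in auto)
  interpret R: pair_graph "\<lparr> pverts = colorings G l,
     parcs = {(c, d). c \<in> colorings G l \<and> d \<in> colorings G l \<and> (\<exists>!v. v \<in> verts G \<and> c v \<noteq> d v)} \<rparr>"
    using fin fin' by unfold_locales (auto simp: symmetric_def sym_def)
  show ?thesis unfolding reconfiguration_graph_def by unfold_locales
qed

end

theory Submission
  imports Defs
begin

text \<open>Fix an induced \<open>W5\<close> with rim \<open>v0, ..., v4\<close>. The forbidden subgraphs determine the adjacency
  between the classes of vertices with given neighbours on the rim: the classes are independent and
  the index graph of the classes is the complement of the icosahedron. Only the vertices without
  neighbours on the rim have some freedom, but \<open>2K2\<close>-freeness makes neighbourhoods inside a class
  nested. Hence \<open>G\<close> retracts, by recoloring every vertex like a vertex of its class with a maximal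
  neighbourhood, to an induced subgraph of that 12-vertex graph containing the wheel.

  Since \<open>W5\<close> is not 3-colorable, at least five colors are available. On the 12-vertex
  graph one first makes the rim 3-colored; from there a canonical 4-coloring with the
  same colors on the wheel can be reached. The fifth color serves to permute the colors of a canonical coloring and to
  rotate it.\<close>

section \<open>Recoloring and retractions\<close>

text \<open>The icosahedron enters through its faces. An independent set of the twelve-vertex graph
  is a clique of the icosahedron, so it has at most three vertices, and a 4-coloring of all twelve
  vertices is a partition into four faces. Every edge of the icosahedron lies in exactly two faces.
  So once the rim carries the colors \<open>p, q, p, q, r\<close>, only \<open>HZ\<close> or
  \<open>B1\<close> can complete \<open>A0\<close>, \<open>A2\<close> to a face; the canonical
  coloring chooses \<open>HZ\<close>, which makes \<open>B1\<close> the one vertex that can stand in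
  the way. Some classes may be empty, hence the recoloring results hold for every vertex set
  containing the wheel rather than for the full twelve vertices. The obstacle on the structural side
  is \<open>HZ\<close>, whose edges to \<open>HU\<close> and to the ring classes are not forced. Its
  representative must see the representatives of all ring classes that occur. This is guaranteed
  only for a vertex whose neighbourhood does not fit below a rim vertex, and the remaining ones have
  to be folded onto the rim.\<close>

definition proper_coloring :: "'v set \<Rightarrow> ('v \<Rightarrow> 'v \<Rightarrow> bool) \<Rightarrow> nat \<Rightarrow> ('v \<Rightarrow> nat) \<Rightarrow> bool" where
  "proper_coloring V E l c \<longleftrightarrow>
     c ` V \<subseteq> {1..l} \<and> (\<forall>x\<in>V. \<forall>y\<in>V. E x y \<longrightarrow> c x \<noteq> c y)"

text \<open>Colorings are total functions here; values outside \<open>V\<close> may change freely.\<close>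

definition recolor_step ::
  "'v set \<Rightarrow> ('v \<Rightarrow> 'v \<Rightarrow> bool) \<Rightarrow> nat \<Rightarrow> ('v \<Rightarrow> nat) \<Rightarrow> ('v \<Rightarrow> nat) \<Rightarrow> bool" where
  "recolor_step V E l c d \<longleftrightarrow>
     proper_coloring V E l c \<and> proper_coloring V E l d \<and> (\<exists>v k. d = c(v := k))"

abbreviation recolor_reach ::
  "'v set \<Rightarrow> ('v \<Rightarrow> 'v \<Rightarrow> bool) \<Rightarrow> nat \<Rightarrow> ('v \<Rightarrow> nat) \<Rightarrow> ('v \<Rightarrow> nat) \<Rightarrow> bool" where
  "recolor_reach V E l \<equiv> (recolor_step V E l)\<^sup>*\<^sup>*"

lemma proper_coloring_edge:
  "proper_coloring V E l c \<Longrightarrow> E x y \<Longrightarrow> x \<in> V \<Longrightarrow> y \<in> V \<Longrightarrow> c x \<noteq> c y"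
  by (auto simp: proper_coloring_def)

lemma proper_coloring_range: "proper_coloring V E l c \<Longrightarrow> x \<in> V \<Longrightarrow> c x \<in> {1..l}"
  by (auto simp: proper_coloring_def)

lemma recolor_step_sym: "recolor_step V E l c d \<Longrightarrow> recolor_step V E l d c"
  unfolding recolor_step_def by (metis fun_upd_triv fun_upd_upd)

lemma recolor_reach_sym: "recolor_reach V E l c d \<Longrightarrow> recolor_reach V E l d c"
  by (induction rule: rtranclp_induct) (auto intro: converse_rtranclp_into_rtranclp recolor_step_sym)

lemma recolor_reach_proper:
  "recolor_reach V E l c d \<Longrightarrow> proper_coloring V E l c \<Longrightarrow> proper_coloring V E l d"
  by (induction rule: rtranclp_induct) (auto simp: recolor_step_def)

lemma recolor_reach_upd:
  assumes "symp E" "irreflp E" "proper_coloring V E l c" "k \<in> {1..l}"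
    and "\<And>y. E v y \<Longrightarrow> y \<in> V \<Longrightarrow> c y \<noteq> k"
  shows "recolor_reach V E l c (c(v := k))"
proof -
  have "proper_coloring V E l (c(v := k))"
    using assms unfolding proper_coloring_def
    by (auto simp: symp_def irreflp_def)
  then show ?thesis using assms(3) by (intro r_into_rtranclp) (auto simp: recolor_step_def)
qed

text \<open>A mixture of two proper colorings is reached vertex by vertex as soon as no edge can ever
  become monochromatic.\<close>

lemma recolor_reach_mix:
  assumes "finite V"
    and "proper_coloring V E l c" "proper_coloring V E l d"
    and "\<And>x y. E x y \<Longrightarrow> x \<in> V \<Longrightarrow> y \<in> V \<Longrightarrow> c x \<noteq> d y \<and> d x \<noteq> c y"
  shows "recolor_reach V E l c (\<lambda>x. if x \<in> V then d x else c x)"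
proof -
  define m where "m W = (\<lambda>x. if x \<in> W then d x else c x)" for W
  have ok: "proper_coloring V E l (m W)" for W
    using assms(2-4) unfolding proper_coloring_def m_def by (auto simp: image_subset_iff)
  have "recolor_reach V E l c (m W)" if "finite W" for W
    using that
  proof (induction W)
    case empty
    have "m {} = c" by (auto simp: m_def)
    then show ?case by simp
  next
    case (insert x F)
    have "m (insert x F) = (m F)(x := d x)" by (auto simp: m_def)
    then have "recolor_step V E l (m F) (m (insert x F))"
      using ok[of F] ok[of "insert x F"] unfolding recolor_step_def by metis
    with insert.IH show ?case by simp
  qed
  from this[OF assms(1)] show ?thesis by (simp add: m_def)
qed

text \<open>The vertex set moves along with the coloring: the set of classes that occur need not be
  invariant under rotation, so \<open>V\<close> is replaced by its preimage.\<close>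

lemma recolor_reach_automorphism:
  assumes "bij f" "\<And>x y. E (f x) (f y) \<longleftrightarrow> E x y"
    and "recolor_reach (f -` V) E l (c \<circ> f) d"
  shows "recolor_reach V E l c (d \<circ> inv f)"
  using assms(3)
proof (induction rule: rtranclp_induct)
  case base
  have "c \<circ> f \<circ> inv f = c" using assms(1) by (auto simp: bij_is_surj surj_f_inv_f)
  then show ?case by (metis rtranclp.rtrancl_refl)
next
  case (step d e)
  have ok: "proper_coloring V E l (h \<circ> inv f)" if "proper_coloring (f -` V) E l h" for h
    using that assms(1) assms(2)[of "inv f x" "inv f y" for x y]
    unfolding proper_coloring_def by (auto simp: bij_is_surj surj_f_inv_f)
  from step obtain v k where e: "e = d(v := k)" by (auto simp: recolor_step_def)
  have "e \<circ> inv f = (d \<circ> inv f)(f v := k)"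
    using assms(1) unfolding e
    by (auto simp: fun_eq_iff bij_is_inj inv_f_f bij_is_surj surj_f_inv_f)
  then have "recolor_step V E l (d \<circ> inv f) (e \<circ> inv f)"
    using ok step.hyps(2) unfolding recolor_step_def by metis
  with step.IH show ?case by (metis rtranclp.rtrancl_into_rtrancl)
qed

text \<open>If \<open>\<sigma>\<close> picks in every fibre of a homomorphism \<open>\<phi>\<close> a vertex of largest neighbourhood,
  then moving all vertices of a fibre to the color of its representative is always possible.\<close>

lemma recolor_reach_retract:
  fixes \<phi> :: "'v \<Rightarrow> 'w" and \<sigma> :: "'w \<Rightarrow> 'v"
  assumes fin: "finite V"
    and E: "symp E"
    and \<phi>: "\<phi> ` V \<subseteq> W" and \<sigma>: "\<sigma> ` W \<subseteq> V"
    and hom: "\<And>x y. x \<in> V \<Longrightarrow> y \<in> V \<Longrightarrow> E x y \<Longrightarrow> F (\<phi> x) (\<phi> y)"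
    and dom: "\<And>x y. x \<in> V \<Longrightarrow> y \<in> V \<Longrightarrow> E x y \<Longrightarrow> E x (\<sigma> (\<phi> y))"
    and sec: "\<And>i j. i \<in> W \<Longrightarrow> j \<in> W \<Longrightarrow> F i j \<Longrightarrow> E (\<sigma> i) (\<sigma> j)"
    and conn: "\<And>c d. proper_coloring W F l c \<Longrightarrow> proper_coloring W F l d \<Longrightarrow> recolor_reach W F l c d"
    and c: "proper_coloring V E l c" and d: "proper_coloring V E l d"
  shows "\<exists>d'. recolor_reach V E l c d' \<and> (\<forall>x\<in>V. d' x = d x)"
proof -
  \<comment> \<open>Agreement on \<open>V\<close> is all that can be expected: mixing keeps the
    starting values outside \<open>V\<close>.\<close>
  define eqv where "eqv c d \<longleftrightarrow> (\<exists>d'. recolor_reach V E l c d' \<and> (\<forall>x\<in>V. d' x = d x))" for c d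
  have pc: "proper_coloring V E l g" if "proper_coloring V E l f" "\<forall>x\<in>V. f x = g x" for f g
    using that by (auto simp: proper_coloring_def image_subset_iff)
  have mix: "eqv f g" if "proper_coloring V E l f" "proper_coloring V E l g"
    "\<And>x y. E x y \<Longrightarrow> x \<in> V \<Longrightarrow> y \<in> V \<Longrightarrow> f x \<noteq> g y" for f g
  proof -
    have "g x \<noteq> f y" if "E x y" "x \<in> V" "y \<in> V" for x y
      using \<open>\<And>x y. E x y \<Longrightarrow> x \<in> V \<Longrightarrow> y \<in> V \<Longrightarrow> f x \<noteq> g y\<close>[of y x] that E by (auto simp: symp_def)
    with that recolor_reach_mix[OF fin that(1,2)] show ?thesis unfolding eqv_def by fastforce
  qed
  have agree: "eqv f g" if "proper_coloring V E l f" "\<forall>x\<in>V. f x = g x" for f g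
    using that unfolding eqv_def by blast
  have trans: "eqv f h" if fg: "eqv f g" and gh: "eqv g h" and f: "proper_coloring V E l f" for f g h
  proof -
    from fg obtain g' where g': "recolor_reach V E l f g'" "\<forall>x\<in>V. g' x = g x"
      by (auto simp: eqv_def)
    from gh obtain h' where h': "recolor_reach V E l g h'" "\<forall>x\<in>V. h' x = h x"
      by (auto simp: eqv_def)
    have "eqv g' h'"
      using h'(1)
    proof (induction rule: rtranclp_induct)
      case base
      then show ?case using g' by (auto simp: eqv_def)
    next
      case (step y z)
      then obtain y' where y': "recolor_reach V E l g' y'" "\<forall>x\<in>V. y' x = y x"
        by (auto simp: eqv_def)
      obtain v k where z: "z = y(v := k)" using step by (auto simp: recolor_step_def)
      have "proper_coloring V E l y'" using y' g'(1) f by (auto dest: recolor_reach_proper)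
      moreover have "proper_coloring V E l (y'(v := k))"
        using step.hyps(2) z y'(2) by - (rule pc[of z]; auto simp: recolor_step_def)
      ultimately have "recolor_step V E l y' (y'(v := k))" by (auto simp: recolor_step_def)
      then have "recolor_reach V E l g' (y'(v := k))" using y' by simp
      then show ?case using z y'(2) by (auto simp: eqv_def)
    qed
    with g' h'(2) show ?thesis unfolding eqv_def by (metis rtranclp_trans)
  qed
  have pull: "proper_coloring V E l (f \<circ> \<phi>)" if "proper_coloring W F l f" for f
    using that \<phi> hom unfolding proper_coloring_def by (fastforce simp: image_subset_iff)
  have push: "proper_coloring W F l (f \<circ> \<sigma>)" if "proper_coloring V E l f" for f
    using that \<sigma> sec unfolding proper_coloring_def by (fastforce simp: image_subset_iff)
  have retract: "eqv f (f \<circ> \<sigma> \<circ> \<phi>)" "eqv (f \<circ> \<sigma> \<circ> \<phi>) f" if f: "proper_coloring V E l f" for f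
  proof -
    \<comment> \<open>By domination \<open>x\<close> is adjacent to the representative of
      \<open>y\<close> too, so giving \<open>y\<close> the color of its representative never clashes
      with the old color of \<open>x\<close>.\<close>
    have ne: "f x \<noteq> f (\<sigma> (\<phi> y))" if "E x y" "x \<in> V" "y \<in> V" for x y
      using f dom[of x y] that \<phi> \<sigma> by (intro proper_coloring_edge[OF f]) auto
    have p: "proper_coloring V E l (f \<circ> \<sigma> \<circ> \<phi>)" using pull[OF push[OF f]] by (simp add: o_assoc)
    show "eqv f (f \<circ> \<sigma> \<circ> \<phi>)" by (rule mix[OF f p]) (use ne in auto)
    show "eqv (f \<circ> \<sigma> \<circ> \<phi>) f"
      by (rule mix[OF p f]) (use ne E in \<open>auto simp: symp_def\<close>, metis)
  qed
  have "eqv (c' \<circ> \<phi>) (d' \<circ> \<phi>)" if c': "proper_coloring W F l c'" and r: "recolor_reach W F l c' d'" for c' d'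
    using r
  proof (induction rule: rtranclp_induct)
    case base
    then show ?case by (auto simp: eqv_def)
  next
    case (step f g)
    then obtain v k where g: "g = f(v := k)" and fg: "proper_coloring W F l f" "proper_coloring W F l g"
      by (auto simp: recolor_step_def)
    \<comment> \<open>One step downstairs recolors a whole fibre. No edge lies inside a fibre, as
      its image would be a loop and contradict properness.\<close>
    have "(f \<circ> \<phi>) x \<noteq> (g \<circ> \<phi>) y" if xy: "E x y" "x \<in> V" "y \<in> V" for x y
    proof -
      have 1: "F (\<phi> x) (\<phi> y)" "\<phi> x \<in> W" "\<phi> y \<in> W" using hom xy \<phi> by auto
      have 2: "f (\<phi> x) \<noteq> f (\<phi> y)" "g (\<phi> x) \<noteq> g (\<phi> y)"
        using 1 fg by (auto dest: proper_coloring_edge)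
      show ?thesis
      proof (cases "\<phi> y = v \<and> \<phi> x = v")
        case False then show ?thesis using 2 unfolding g by (auto split: if_splits)
      next
        case True then show ?thesis using 2 by auto
      qed
    qed
    then have "eqv (f \<circ> \<phi>) (g \<circ> \<phi>)" using mix pull fg by blast
    with step.IH show ?case using trans pull c' by blast
  qed
  then have "eqv (c \<circ> \<sigma> \<circ> \<phi>) (d \<circ> \<sigma> \<circ> \<phi>)" using conn push c d by blast
  with retract c d show ?thesis unfolding eqv_def[symmetric]
    by (metis trans pull push)
qed

section \<open>The complement of the icosahedron\<close>

text \<open>In a graph as in the theorem, the vertices fall into twelve classes according to their
  neighbours on the 5-cycle \<open>v0, ..., v4\<close> of an induced \<open>W5\<close>: those adjacent to the two neighbours
  of \<open>vi\<close> only (\<open>Ai\<close>), to \<open>vi\<close> and the two vertices opposite to it (\<open>Bi\<close>), to all five (\<open>HU\<close>,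
  which contains the hub), and to none (\<open>HZ\<close>). The type \<open>ico\<close> indexes the classes.\<close>

datatype ico = A0 | A1 | A2 | A3 | A4 | B0 | B1 | B2 | B3 | B4 | HU | HZ

primrec ico_nbrs :: "ico \<Rightarrow> ico set" where
  "ico_nbrs A0 = {A1, A4, HU, B0, B2, B3}"
| "ico_nbrs A1 = {A2, A0, HU, B1, B3, B4}"
| "ico_nbrs A2 = {A3, A1, HU, B2, B4, B0}"
| "ico_nbrs A3 = {A4, A2, HU, B3, B0, B1}"
| "ico_nbrs A4 = {A0, A3, HU, B4, B1, B2}"
| "ico_nbrs B0 = {A0, A2, A3, B1, B4, HZ}"
| "ico_nbrs B1 = {A1, A3, A4, B2, B0, HZ}"
| "ico_nbrs B2 = {A2, A4, A0, B3, B1, HZ}"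
| "ico_nbrs B3 = {A3, A0, A1, B4, B2, HZ}"
| "ico_nbrs B4 = {A4, A1, A2, B0, B3, HZ}"
| "ico_nbrs HU = {A0, A1, A2, A3, A4, HZ}"
| "ico_nbrs HZ = {HU, B0, B1, B2, B3, B4}"

definition ico_adj :: "ico \<Rightarrow> ico \<Rightarrow> bool" where
  "ico_adj x y \<longleftrightarrow> y \<in> ico_nbrs x"

primrec ico_rot :: "ico \<Rightarrow> ico" where
  "ico_rot A0 = A1" | "ico_rot A1 = A2" | "ico_rot A2 = A3" | "ico_rot A3 = A4" | "ico_rot A4 = A0"
| "ico_rot B0 = B1" | "ico_rot B1 = B2" | "ico_rot B2 = B3" | "ico_rot B3 = B4" | "ico_rot B4 = B0"
| "ico_rot HU = HU" | "ico_rot HZ = HZ"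

abbreviation ico_rim :: "ico set" where "ico_rim \<equiv> {A0, A1, A2, A3, A4}"

abbreviation ico_ring :: "ico set" where "ico_ring \<equiv> {B0, B1, B2, B3, B4}"

abbreviation ico_wheel :: "ico set" where
  "ico_wheel \<equiv> {A0, A1, A2, A3, A4, HU}"

text \<open>The color classes are four faces of the icosahedron: \<open>A0 A2 HZ\<close>,
  \<open>A1 A3 B2\<close>, \<open>A4 B0 B3\<close> and \<open>HU B1 B4\<close>.\<close>

primrec ico_canon :: "nat \<Rightarrow> nat \<Rightarrow> nat \<Rightarrow> nat \<Rightarrow> ico \<Rightarrow> nat" where
  "ico_canon p q r s A0 = p" | "ico_canon p q r s A1 = q" | "ico_canon p q r s A2 = p"
| "ico_canon p q r s A3 = q" | "ico_canon p q r s A4 = r"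
| "ico_canon p q r s B0 = r" | "ico_canon p q r s B1 = s" | "ico_canon p q r s B2 = q"
| "ico_canon p q r s B3 = r" | "ico_canon p q r s B4 = s"
| "ico_canon p q r s HU = s" | "ico_canon p q r s HZ = p"

lemma symp_ico_adj: "symp ico_adj"
proof (rule sympI)
  show "ico_adj y x" if "ico_adj x y" for x y
    using that by (cases x) (auto simp: ico_adj_def)
qed

lemma irreflp_ico_adj: "irreflp ico_adj"
proof (rule irreflpI)
  show "\<not> ico_adj x x" for x by (cases x) (auto simp: ico_adj_def)
qed

lemma bij_ico_rot: "bij ico_rot"
proof -
  have "inj ico_rot"
  proof (rule injI)
    show "x = y" if "ico_rot x = ico_rot y" for x y using that by (cases x; cases y) auto
  qed
  moreover have "\<exists>x. y = ico_rot x" for y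
    by (cases y) (metis ico_rot.simps)+
  then have "surj ico_rot" by blast
  ultimately show ?thesis by (simp add: bij_def)
qed

lemma ico_adj_rot: "ico_adj (ico_rot x) (ico_rot y) \<longleftrightarrow> ico_adj x y"
  by (cases x; cases y) (auto simp: ico_adj_def)

lemma ico_reach_upd:
  assumes "proper_coloring V ico_adj l c" "k \<in> {1..l}"
    and "\<forall>y\<in>ico_nbrs v. y \<in> V \<longrightarrow> c y \<noteq> k"
  shows "recolor_reach V ico_adj l c (c(v := k))"
  using assms by (intro recolor_reach_upd[OF symp_ico_adj irreflp_ico_adj]) (auto simp: ico_adj_def)

lemma ico_reach_upd_trans:
  assumes "proper_coloring V ico_adj l c" "k \<in> {1..l}"
    and "\<forall>y\<in>ico_nbrs v. y \<in> V \<longrightarrow> c y \<noteq> k"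
    and "proper_coloring V ico_adj l (c(v := k)) \<Longrightarrow> recolor_reach V ico_adj l (c(v := k)) d"
  shows "recolor_reach V ico_adj l c d"
proof -
  have "recolor_reach V ico_adj l c (c(v := k))" using assms(1-3) by (rule ico_reach_upd)
  moreover from recolor_reach_proper[OF this assms(1)]
  have "recolor_reach V ico_adj l (c(v := k)) d" by (rule assms(4))
  ultimately show ?thesis by (rule rtranclp_trans)
qed

lemma ico_proper_edges:
  assumes "proper_coloring V ico_adj l c"
  shows "\<And>x y. y \<in> ico_nbrs x \<Longrightarrow> x \<in> V \<Longrightarrow> y \<in> V \<Longrightarrow> c x \<noteq> c y"
  using assms by (auto simp: proper_coloring_def ico_adj_def)

lemma ico_proper_inner:
  assumes "proper_coloring V ico_adj l c" "ico_wheel \<subseteq> V"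
  shows "c A0 \<noteq> c A1" "c A1 \<noteq> c A2" "c A2 \<noteq> c A3" "c A3 \<noteq> c A4" "c A4 \<noteq> c A0"
    "c HU \<noteq> c A0" "c HU \<noteq> c A1" "c HU \<noteq> c A2" "c HU \<noteq> c A3" "c HU \<noteq> c A4"
  using assms(2) ico_proper_edges[OF assms(1)] by simp_all

lemma ico_proper_outer:
  assumes "proper_coloring V ico_adj l c" "ico_wheel \<subseteq> V"
  shows "B0 \<in> V \<Longrightarrow> c B0 \<noteq> c A0 \<and> c B0 \<noteq> c A2 \<and> c B0 \<noteq> c A3"
    "B1 \<in> V \<Longrightarrow> c B1 \<noteq> c A1 \<and> c B1 \<noteq> c A3 \<and> c B1 \<noteq> c A4"
    "B2 \<in> V \<Longrightarrow> c B2 \<noteq> c A2 \<and> c B2 \<noteq> c A4 \<and> c B2 \<noteq> c A0"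
    "B3 \<in> V \<Longrightarrow> c B3 \<noteq> c A3 \<and> c B3 \<noteq> c A0 \<and> c B3 \<noteq> c A1"
    "B4 \<in> V \<Longrightarrow> c B4 \<noteq> c A4 \<and> c B4 \<noteq> c A1 \<and> c B4 \<noteq> c A2"
    "HZ \<in> V \<Longrightarrow> c HZ \<noteq> c HU"
  using assms(2) ico_proper_edges[OF assms(1)] by auto

section \<open>From a 3-colored rim to the canonical coloring\<close>

lemma fresh_color:
  assumes "finite X" "card X < l"
  obtains t where "t \<in> {1..l}" "t \<notin> X"
proof -
  have "\<not> {1..l} \<subseteq> X" using card_mono[OF assms(1), of "{1..l}"] assms(2) by auto
  then show ?thesis using that by blast
qed

lemma fresh_color4:
  fixes p q r s :: nat
  assumes "5 \<le> l"
  obtains t where "t \<in> {1..l}" "t \<notin> {p, q, r, s}"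
  by (rule fresh_color[of "{p,q,r,s}" l])
    (use assms card_length[of "[p,q,r,s]"] in auto)

text \<open>The only obstruction to reaching the canonical coloring is \<open>B1\<close> sharing its color with
  \<open>A0\<close> and \<open>A2\<close>.\<close>

lemma ico_reach_canon_unobstructed:
  assumes c: "proper_coloring V ico_adj l c" and V: "ico_wheel \<subseteq> V"
    and p: "c A0 = p" "c A2 = p" and q: "c A1 = q" "c A3 = q" and r: "c A4 = r" and s: "c HU = s"
    and b1: "B1 \<in> V \<Longrightarrow> c B1 \<noteq> p"
  shows "recolor_reach V ico_adj l c (ico_canon p q r s)"
proof -
  note ne = ico_proper_inner[OF c V, unfolded p q r s]
  note out = ico_proper_outer[OF c V, unfolded p q r s]
  have rng: "p \<in> {1..l}" "q \<in> {1..l}" "r \<in> {1..l}" "s \<in> {1..l}"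
    using V p q r s proper_coloring_range[OF c] by auto
  let ?d = "c(HZ := p, B0 := r, B2 := q, B3 := r, B1 := s, B4 := s)"
  have "ico_canon p q r s x = ?d x" for x
    by (cases x) (use p q r s in auto)
  then have d: "ico_canon p q r s = ?d" by blast
  \<comment> \<open>\<open>B1\<close> and \<open>B4\<close> come last: the hub color
    \<open>s\<close> is safe for them only once \<open>B0\<close>, \<open>B2\<close> and
    \<open>B3\<close> carry rim colors.\<close>
  show ?thesis unfolding d
    apply (rule ico_reach_upd_trans[OF c, of p HZ])
      apply (use rng in simp)
     apply (simp add: ne ne[symmetric] out b1 p q r s)
    apply (erule ico_reach_upd_trans[of _ _ _ r B0])
      apply (use rng in simp)
     apply (simp add: ne ne[symmetric] out b1 p q r s)
    apply (erule ico_reach_upd_trans[of _ _ _ q B2])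
      apply (use rng in simp)
     apply (simp add: ne ne[symmetric] out b1 p q r s)
    apply (erule ico_reach_upd_trans[of _ _ _ r B3])
      apply (use rng in simp)
     apply (simp add: ne ne[symmetric] out b1 p q r s)
    apply (erule ico_reach_upd_trans[of _ _ _ s B1])
      apply (use rng in simp)
     apply (simp add: ne ne[symmetric] out b1 p q r s)
    apply (erule ico_reach_upd_trans[of _ _ _ s B4])
      apply (use rng in simp)
     apply (simp add: ne ne[symmetric] out b1 p q r s)
    apply simp
    done
qed

text \<open>\<open>B1\<close> is first moved off \<open>p\<close>. Its rim neighbours use only
  \<open>q\<close> and \<open>r\<close>, so \<open>s\<close> or a fifth color is available once at
  most one of \<open>B0\<close>, \<open>B2\<close>, \<open>HZ\<close> has a color other than
  \<open>q\<close> and \<open>r\<close>. The color of \<open>HZ\<close> decides which of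
  \<open>B0\<close> and \<open>B2\<close> is prepared for this.\<close>

lemma ico_reach_canon:
  assumes c: "proper_coloring V ico_adj l c" and V: "ico_wheel \<subseteq> V" and l: "5 \<le> l"
    and p: "c A0 = p" "c A2 = p" and q: "c A1 = q" "c A3 = q" and r: "c A4 = r" and s: "c HU = s"
  shows "recolor_reach V ico_adj l c (ico_canon p q r s)"
proof -
  note ne = ico_proper_inner[OF c V, unfolded p q r s]
  note out = ico_proper_outer[OF c V, unfolded p q r s]
  have rng: "p \<in> {1..l}" "q \<in> {1..l}" "r \<in> {1..l}" "s \<in> {1..l}"
    using V p q r s proper_coloring_range[OF c] by auto
  obtain t where t: "t \<in> {1..l}" "t \<notin> {p, q, r, s}" using fresh_color4[OF l] .
  have fin: "recolor_reach V ico_adj l d (ico_canon p q r s)"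
    if "proper_coloring V ico_adj l d" "\<And>x. x \<in> ico_wheel \<Longrightarrow> d x = c x" "d B1 \<noteq> p" for d
    using that p q r s by (intro ico_reach_canon_unobstructed[OF _ V]) auto
  show ?thesis
  proof (cases "HZ \<in> V \<and> c HZ = r")
    case True
    define u where "u = (if c B0 = s then t else s)"
    have u: "u \<in> {1..l}" "u \<noteq> p" "q \<noteq> u" "r \<noteq> u" "B0 \<in> V \<Longrightarrow> c B0 \<noteq> u"
      using t rng ne unfolding u_def by auto
    show ?thesis
      apply (rule ico_reach_upd_trans[OF c, of q B2])
        apply (use rng in simp)
       apply (simp add: ne ne[symmetric] out p q r s True)
      apply (erule ico_reach_upd_trans[of _ _ _ u B1])
        apply (use u in simp)
       apply (simp add: ne ne[symmetric] out p q r s u True)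
      apply (erule fin)
       apply (use u in auto)
      done
  next
    case False
    define u where "u = (if (B2 \<in> V \<and> c B2 = s) then t else s)"
    show ?thesis
    proof (cases "HZ \<in> V \<and> c HZ = q")
      case True
      have u: "u \<in> {1..l}" "u \<noteq> p" "q \<noteq> u" "r \<noteq> u" "B2 \<in> V \<Longrightarrow> c B2 \<noteq> u"
        using t rng ne unfolding u_def by auto
      show ?thesis
        apply (rule ico_reach_upd_trans[OF c, of r B0])
          apply (use rng in simp)
         apply (simp add: ne ne[symmetric] out p q r s True)
        apply (erule ico_reach_upd_trans[of _ _ _ u B1])
          apply (use u in simp)
         apply (simp add: ne ne[symmetric] out p q r s u True)
        apply (erule fin)
         apply (use u in auto)
        done
    next
      case Q: False
      have z: "HZ \<in> V \<Longrightarrow> c HZ \<noteq> r" "HZ \<in> V \<Longrightarrow> c HZ \<noteq> q" using False Q by blast+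
      show ?thesis
        apply (rule ico_reach_upd_trans[OF c, of r B0])
          apply (use rng in simp)
         apply (simp add: ne ne[symmetric] out p q r s z)
        apply (erule ico_reach_upd_trans[of _ _ _ q B2])
          apply (use rng in simp)
         apply (simp add: ne ne[symmetric] out p q r s z)
        \<comment> \<open>\<open>HZ\<close> is adjacent to \<open>HU\<close>, so whatever its color
          is, it is not \<open>s\<close>.\<close>
        apply (erule ico_reach_upd_trans[of _ _ _ s B1])
          apply (use rng in simp)
         apply (simp add: ne ne[symmetric] out p q r s z)
        apply (erule fin)
         apply (use ne in auto)
        done
    qed
  qed
qed

text \<open>Canonical colorings make sense on all twelve vertices, so paths between them are built
  once on \<open>UNIV\<close> and then restricted to the classes that occur.\<close>

lemma recolor_reach_subset:
  assumes "recolor_reach W E l c d" "V \<subseteq> W"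
  shows "recolor_reach V E l c d"
proof -
  have "proper_coloring V E l c" if "proper_coloring W E l c" for c
    using that assms(2) by (auto simp: proper_coloring_def image_subset_iff subset_eq)
  then have "recolor_step W E l \<le> recolor_step V E l"
    by (auto simp: recolor_step_def)
  then show ?thesis using assms(1) rtranclp_mono by blast
qed

section \<open>Permuting and rotating canonical colorings\<close>

definition color_quad :: "nat \<Rightarrow> nat \<Rightarrow> nat \<Rightarrow> nat \<Rightarrow> nat \<Rightarrow> bool" where
  "color_quad l p q r s \<longleftrightarrow> distinct [p, q, r, s] \<and> {p, q, r, s} \<subseteq> {1..l}"

lemma finite_ico [simp]: "finite (V :: ico set)"
proof -
  have "x \<in> {A0, A1, A2, A3, A4, B0, B1, B2, B3, B4, HU, HZ}" for x
    by (cases x) auto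
  then have "UNIV \<subseteq> {A0, A1, A2, A3, A4, B0, B1, B2, B3, B4, HU, HZ}" by blast
  then show ?thesis by (rule finite_subset[OF subset_trans[OF subset_UNIV]]) simp
qed

lemma ico_canon_range:
  "color_quad l p q r s \<Longrightarrow> ico_canon p q r s x \<in> {1..l}"
  by (cases x) (auto simp: color_quad_def)

lemma ico_canon_proper:
  assumes "color_quad l p q r s"
  shows "proper_coloring UNIV ico_adj l (ico_canon p q r s)"
  unfolding proper_coloring_def
proof (intro conjI ballI impI)
  show "ico_canon p q r s ` UNIV \<subseteq> {1..l}" using ico_canon_range[OF assms] by blast
  show "ico_canon p q r s x \<noteq> ico_canon p q r s y" if "ico_adj x y" for x y
    using that assms unfolding ico_adj_def color_quad_def by (cases x) auto
qed

text \<open>Both colorings have the same color classes, so a mixture can fail only where the new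
  color of one class is the old color of another.\<close>

lemma ico_canon_change:
  assumes "color_quad l p q r s" "color_quad l p' q' r' s'"
    and "p' \<notin> {q, r, s}" "q' \<notin> {p, r, s}" "r' \<notin> {p, q, s}" "s' \<notin> {p, q, r}"
  shows "recolor_reach UNIV ico_adj l (ico_canon p q r s) (ico_canon p' q' r' s')"
proof -
  have "ico_canon p q r s x \<noteq> ico_canon p' q' r' s' y
      \<and> ico_canon p' q' r' s' x \<noteq> ico_canon p q r s y" if "ico_adj x y" for x y
    using that assms(3-6) unfolding ico_adj_def by (cases x) auto
  from recolor_reach_mix[OF _ ico_canon_proper ico_canon_proper this, OF _ assms(1,2)]
  show ?thesis by simp
qed

lemma color_quad_fresh:
  fixes p q r s :: nat
  assumes "5 \<le> l"
  obtains t where "t \<in> {1..l}" "t \<noteq> p" "t \<noteq> q" "t \<noteq> r" "t \<noteq> s"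
  using fresh_color4[OF assms, of p q r s] by blast

text \<open>As in a sliding puzzle, a class that occupies \<open>p'\<close> escapes to a fresh color
  \<open>t\<close>, after which the first class can take \<open>p'\<close>. The second and third
  classes are treated alike, without touching those already set.\<close>

lemma ico_canon_set_first:
  assumes l: "5 \<le> l" and c: "color_quad l p q r s" and p': "p' \<in> {1..l}"
  shows "\<exists>q2 r2 s2. color_quad l p' q2 r2 s2 \<and>
     recolor_reach UNIV ico_adj l (ico_canon p q r s) (ico_canon p' q2 r2 s2)"
proof -
  obtain t where t: "t \<in> {1..l}" "t \<noteq> p" "t \<noteq> q" "t \<noteq> r" "t \<noteq> s"
    using color_quad_fresh[OF l] .
  define q2 r2 s2 where "q2 = (if q = p' then t else q)" and "r2 = (if r = p' then t else r)"
    and "s2 = (if s = p' then t else s)"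
  note d = q2_def r2_def s2_def
  have "recolor_reach UNIV ico_adj l (ico_canon p q r s) (ico_canon p q2 r2 s2)"
    by (rule ico_canon_change) (use t p' c in \<open>auto simp: color_quad_def d\<close>)
  moreover have "recolor_reach UNIV ico_adj l (ico_canon p q2 r2 s2) (ico_canon p' q2 r2 s2)" if "p \<noteq> p'"
    by (rule ico_canon_change) (use t p' c that in \<open>auto simp: color_quad_def d\<close>)
  moreover have "color_quad l p' q2 r2 s2"
    using t p' c by (auto simp: color_quad_def d)
  ultimately show ?thesis by (metis rtranclp_trans)
qed

lemma ico_canon_set_second:
  assumes l: "5 \<le> l" and c: "color_quad l p q r s" and q': "q' \<in> {1..l}" "q' \<noteq> p"
  shows "\<exists>r2 s2. color_quad l p q' r2 s2 \<and>
     recolor_reach UNIV ico_adj l (ico_canon p q r s) (ico_canon p q' r2 s2)"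
proof -
  obtain t where t: "t \<in> {1..l}" "t \<noteq> p" "t \<noteq> q" "t \<noteq> r" "t \<noteq> s"
    using color_quad_fresh[OF l] .
  define r2 s2 where "r2 = (if r = q' then t else r)" and "s2 = (if s = q' then t else s)"
  note d = r2_def s2_def
  have "recolor_reach UNIV ico_adj l (ico_canon p q r s) (ico_canon p q r2 s2)"
    by (rule ico_canon_change) (use t q' c in \<open>auto simp: color_quad_def d\<close>)
  moreover have "recolor_reach UNIV ico_adj l (ico_canon p q r2 s2) (ico_canon p q' r2 s2)" if "q \<noteq> q'"
    by (rule ico_canon_change) (use t q' c that in \<open>auto simp: color_quad_def d\<close>)
  moreover have "color_quad l p q' r2 s2"
    using t q' c by (auto simp: color_quad_def d)
  ultimately show ?thesis by (metis rtranclp_trans)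
qed

lemma ico_canon_set_third:
  assumes l: "5 \<le> l" and c: "color_quad l p q r s" and r': "r' \<in> {1..l}" "r' \<noteq> p" "r' \<noteq> q"
  shows "\<exists>s2. color_quad l p q r' s2 \<and>
     recolor_reach UNIV ico_adj l (ico_canon p q r s) (ico_canon p q r' s2)"
proof -
  obtain t where t: "t \<in> {1..l}" "t \<noteq> p" "t \<noteq> q" "t \<noteq> r" "t \<noteq> s"
    using color_quad_fresh[OF l] .
  define s2 where "s2 = (if s = r' then t else s)"
  have "recolor_reach UNIV ico_adj l (ico_canon p q r s) (ico_canon p q r s2)"
    by (rule ico_canon_change) (use t r' c in \<open>auto simp: color_quad_def s2_def\<close>)
  moreover have "recolor_reach UNIV ico_adj l (ico_canon p q r s2) (ico_canon p q r' s2)" if "r \<noteq> r'"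
    by (rule ico_canon_change) (use t r' c that in \<open>auto simp: color_quad_def s2_def\<close>)
  moreover have "color_quad l p q r' s2"
    using t r' c by (auto simp: color_quad_def s2_def)
  ultimately show ?thesis by (metis rtranclp_trans)
qed

lemma ico_canon_permute:
  assumes l: "5 \<le> l" and c: "color_quad l p q r s" and d: "color_quad l p' q' r' s'"
  shows "recolor_reach UNIV ico_adj l (ico_canon p q r s) (ico_canon p' q' r' s')"
proof -
  have d': "p' \<in> {1..l}" "q' \<in> {1..l}" "q' \<noteq> p'" "r' \<in> {1..l}" "r' \<noteq> p'" "r' \<noteq> q'"
    using d by (auto simp: color_quad_def)
  obtain q1 r1 s1 where 1: "color_quad l p' q1 r1 s1"
    "recolor_reach UNIV ico_adj l (ico_canon p q r s) (ico_canon p' q1 r1 s1)"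
    using ico_canon_set_first[OF l c d'(1)] by blast
  obtain r2 s2 where 2: "color_quad l p' q' r2 s2"
    "recolor_reach UNIV ico_adj l (ico_canon p' q1 r1 s1) (ico_canon p' q' r2 s2)"
    using ico_canon_set_second[OF l 1(1) d'(2,3)] by blast
  obtain s3 where 3: "color_quad l p' q' r' s3"
    "recolor_reach UNIV ico_adj l (ico_canon p' q' r2 s2) (ico_canon p' q' r' s3)"
    using ico_canon_set_third[OF l 2(1) d'(4-6)] by blast
  \<comment> \<open>\<open>s'\<close> differs from the three colors already in place, so the last
    class changes directly.\<close>
  have "recolor_reach UNIV ico_adj l (ico_canon p' q' r' s3) (ico_canon p' q' r' s')"
    by (rule ico_canon_change[OF 3(1) d]) (use 3(1) d in \<open>auto simp: color_quad_def\<close>)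
  with 1(2) 2(2) 3(2) show ?thesis by (meson rtranclp_trans)
qed

text \<open>Spreading a fifth color makes the rim follow the canonical pattern shifted by one.\<close>

lemma ico_canon_rotate:
  assumes l: "5 \<le> l" and c: "color_quad l p q r s"
    and t: "t \<in> {1..l}" "p \<noteq> t" "q \<noteq> t" "r \<noteq> t" "s \<noteq> t"
  shows "recolor_reach UNIV ico_adj l (ico_canon p q r s) (ico_canon q r t s \<circ> inv ico_rot)"
proof -
  have ne: "p \<noteq> q" "p \<noteq> r" "p \<noteq> s" "q \<noteq> r" "q \<noteq> s" "r \<noteq> s"
    and rng: "p \<in> {1..l}" "q \<in> {1..l}" "r \<in> {1..l}" "s \<in> {1..l}"
    using c by (auto simp: color_quad_def)
  \<comment> \<open>The aim is the rim \<open>t, q, r, q, r\<close>. For \<open>A2\<close> to take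
    \<open>r\<close>, its neighbour \<open>B0\<close> must leave \<open>r\<close>; it can take
    \<open>s\<close> only after \<open>B1\<close> and \<open>B4\<close> have left \<open>s\<close>.
    These two form a face with \<open>A0\<close>, so all three can share \<open>t\<close>.\<close>
  define d where "d = (ico_canon p q r s)(A0 := t, B4 := t, B1 := t, B0 := s, A2 := r)"
  have d1: "recolor_reach UNIV ico_adj l (ico_canon p q r s) d"
    unfolding d_def
    apply (rule ico_reach_upd_trans[OF ico_canon_proper[OF c] t(1), of A0])
     apply (simp add: t)
    apply (erule ico_reach_upd_trans[OF _ t(1), of _ _ B4])
     apply (simp add: t)
    apply (erule ico_reach_upd_trans[OF _ t(1), of _ _ B1])
     apply (simp add: t)
    apply (erule ico_reach_upd_trans[OF _ rng(4), of _ _ B0])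
     apply (simp add: t t(2-)[symmetric] ne)
    apply (erule ico_reach_upd_trans[OF _ rng(3), of _ _ A2])
     apply (simp add: t t(2-)[symmetric] ne ne[symmetric])
    apply simp
    done
  have "proper_coloring UNIV ico_adj l d"
    using recolor_reach_proper[OF d1 ico_canon_proper[OF c]] .
  then have "proper_coloring UNIV ico_adj l (d \<circ> ico_rot)"
    by (auto simp: proper_coloring_def image_subset_iff ico_adj_rot)
  then have "recolor_reach (ico_rot -` UNIV) ico_adj l (d \<circ> ico_rot) (ico_canon q r t s)"
    using l by (intro ico_reach_canon) (auto simp: d_def)
  from recolor_reach_automorphism[OF bij_ico_rot ico_adj_rot this] d1
  show ?thesis by simp
qed

section \<open>Joining every coloring to one base coloring\<close>

definition ico_base :: "ico \<Rightarrow> nat" where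
  "ico_base = ico_canon 1 2 3 4"

lemma ico_reach_base_rot:
  assumes l: "5 \<le> l" and "recolor_reach (ico_rot -` V) ico_adj l (c \<circ> ico_rot) ico_base"
  shows "recolor_reach V ico_adj l c ico_base"
proof -
  \<comment> \<open>The quadruple 5, 1, 2, 4 with fresh color 3 is chosen so that rotation ends in
    the pattern 1, 2, 3, 4 of \<open>ico_base\<close>.\<close>
  have "recolor_reach UNIV ico_adj l (ico_canon 5 1 2 4) (ico_base \<circ> inv ico_rot)"
    unfolding ico_base_def using l by (intro ico_canon_rotate) (auto simp: color_quad_def)
  moreover have "recolor_reach UNIV ico_adj l (ico_canon 5 1 2 4) ico_base"
    unfolding ico_base_def using l by (intro ico_canon_permute) (auto simp: color_quad_def)
  ultimately have "recolor_reach UNIV ico_adj l (ico_base \<circ> inv ico_rot) ico_base"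
    by (meson recolor_reach_sym rtranclp_trans)
  then have "recolor_reach V ico_adj l (ico_base \<circ> inv ico_rot) ico_base"
    by (rule recolor_reach_subset) simp
  with recolor_reach_automorphism[OF bij_ico_rot ico_adj_rot assms(2)]
  show ?thesis by simp
qed

lemma ico_proper_rot:
  "proper_coloring V ico_adj l c \<Longrightarrow> proper_coloring (ico_rot -` V) ico_adj l (c \<circ> ico_rot)"
  by (auto simp: proper_coloring_def image_subset_iff ico_adj_rot)

lemma ico_reach_base_rotI:
  assumes "proper_coloring V ico_adj l c" "ico_wheel \<subseteq> V" "5 \<le> l"
    and "\<And>V' c'. \<lbrakk>proper_coloring V' ico_adj l c'; ico_wheel \<subseteq> V'; \<And>x. c' x = c (ico_rot x)\<rbrakk>
      \<Longrightarrow> recolor_reach V' ico_adj l c' ico_base"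
  shows "recolor_reach V ico_adj l c ico_base"
  by (rule ico_reach_base_rot[OF assms(3)], rule assms(4)[OF ico_proper_rot[OF assms(1)]])
    (use assms(2) in auto)

lemma ico_reach_base_02_13:
  assumes c: "proper_coloring V ico_adj l c" and V: "ico_wheel \<subseteq> V" and l: "5 \<le> l"
    and "c A0 = c A2" "c A1 = c A3"
  shows "recolor_reach V ico_adj l c ico_base"
proof -
  have "recolor_reach V ico_adj l c (ico_canon (c A0) (c A1) (c A4) (c HU))"
    using assms by (intro ico_reach_canon) auto
  moreover have "c A1 \<noteq> c A4" using ico_proper_inner(4)[OF c V] assms(5) by simp
  then have "distinct [c A0, c A1, c A4, c HU]"
    using ico_proper_inner(1,5,6,7,10)[OF c V] by fastforce
  then have "color_quad l (c A0) (c A1) (c A4) (c HU)"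
    using proper_coloring_range[OF c] V unfolding color_quad_def by blast
  then have "recolor_reach UNIV ico_adj l (ico_canon (c A0) (c A1) (c A4) (c HU)) ico_base"
    unfolding ico_base_def using l by (intro ico_canon_permute) (auto simp: color_quad_def)
  then have "recolor_reach V ico_adj l (ico_canon (c A0) (c A1) (c A4) (c HU)) ico_base"
    by (rule recolor_reach_subset) simp
  ultimately show ?thesis by simp
qed

text \<open>These equalities are those of \<open>ico_reach_base_02_13\<close> shifted by four
  places, so four rotations reduce to it.\<close>

lemma ico_reach_base_41_02:
  assumes "proper_coloring V ico_adj l c" "ico_wheel \<subseteq> V" "5 \<le> l"
    and "c A4 = c A1" "c A0 = c A2"
  shows "recolor_reach V ico_adj l c ico_base"
proof -
  note rot = ico_reach_base_rotI[OF _ _ assms(3)]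
  have 1: "recolor_reach V ico_adj l c ico_base"
    if "proper_coloring V ico_adj l c" "ico_wheel \<subseteq> V" "c A1 = c A3" "c A2 = c A4" for V c
    by (rule rot[OF that(1,2)], rule ico_reach_base_02_13[OF _ _ assms(3)]) (simp_all add: that)
  have 2: "recolor_reach V ico_adj l c ico_base"
    if "proper_coloring V ico_adj l c" "ico_wheel \<subseteq> V" "c A2 = c A4" "c A3 = c A0" for V c
    by (rule rot[OF that(1,2)], rule 1) (simp_all add: that)
  have 3: "recolor_reach V ico_adj l c ico_base"
    if "proper_coloring V ico_adj l c" "ico_wheel \<subseteq> V" "c A3 = c A0" "c A4 = c A1" for V c
    by (rule rot[OF that(1,2)], rule 2) (simp_all add: that)
  show ?thesis
    by (rule rot[OF assms(1,2)], rule 3) (simp_all add: assms)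
qed

text \<open>Each of four moves on the rim saves a color, unless one particular ring vertex blocks it.
  If all four are blocked, recoloring \<open>B3\<close> with the color of the hub frees one of them.\<close>

lemma ico_reach_base_02:
  assumes c: "proper_coloring V ico_adj l c" and V: "ico_wheel \<subseteq> V" and l: "5 \<le> l"
    and eq: "c A0 = c A2"
  shows "recolor_reach V ico_adj l c ico_base"
proof -
  note ne = ico_proper_inner[OF c V]
  note out = ico_proper_outer[OF c V]
  have A24: "c A2 \<noteq> c A4" using ne(5) eq by simp
  note nes = ne ne[symmetric] A24 A24[symmetric] out
  have rng: "c A1 \<in> {1..l}" "c A3 \<in> {1..l}" "c A4 \<in> {1..l}" "c HU \<in> {1..l}"
    using V proper_coloring_range[OF c] by auto
  consider "c A1 = c A3" | "c A1 = c A4"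
    | (ne) "c A1 \<noteq> c A3" "c A1 \<noteq> c A4" by blast
  then show ?thesis
  proof cases
    case 1
    then show ?thesis using eq by (intro ico_reach_base_02_13[OF c V l]) auto
  next
    case 2
    then show ?thesis using eq by (intro ico_reach_base_41_02[OF c V l]) auto
  next
    case ne
    note ne' = ne ne[symmetric]
    \<comment> \<open>For each move, the other ring neighbours of the recolored vertex are adjacent
      to the rim vertex whose color it takes, so just one ring vertex can block.\<close>
    consider (b0) "B0 \<in> V \<Longrightarrow> c B0 \<noteq> c A1" | (b2) "B2 \<in> V \<Longrightarrow> c B2 \<noteq> c A1"
      | (b4) "B4 \<in> V \<Longrightarrow> c B4 \<noteq> c A3" | (b3) "B3 \<in> V \<Longrightarrow> c B3 \<noteq> c A4"
      | (blocked) "B0 \<in> V" "B2 \<in> V" "B3 \<in> V" "B4 \<in> V"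
          "c B0 = c A1" "c B2 = c A1" "c B4 = c A3" "c B3 = c A4" by blast
    then show ?thesis
    proof cases
      case b0
      then show ?thesis
        by (intro ico_reach_upd_trans[OF c rng(1), of A3] ico_reach_base_02_13[OF _ V l])
          (simp_all add: nes ne' eq)
    next
      case b2
      then show ?thesis
        by (intro ico_reach_upd_trans[OF c rng(1), of A4] ico_reach_base_41_02[OF _ V l])
          (simp_all add: nes ne' eq)
    next
      case b4
      then show ?thesis
        by (intro ico_reach_upd_trans[OF c rng(2), of A1] ico_reach_base_02_13[OF _ V l])
          (simp_all add: nes ne' eq)
    next
      case b3
      then show ?thesis
        by (intro ico_reach_upd_trans[OF c rng(3), of A1] ico_reach_base_41_02[OF _ V l])
          (simp_all add: nes ne' eq)
    next
      case blocked
      \<comment> \<open>The hub color is free at \<open>B3\<close>: the rim avoids it,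
        \<open>HZ\<close> is adjacent to \<open>HU\<close>, and \<open>B2\<close> and
        \<open>B4\<close> carry rim colors because they block.\<close>
      show ?thesis
        apply (rule ico_reach_upd_trans[OF c rng(4), of B3])
         apply (simp add: nes ne' blocked)
        apply (erule ico_reach_upd_trans[OF _ rng(3), of _ _ A1])
         apply (simp add: nes ne' blocked)
        apply (erule ico_reach_base_41_02[OF _ V l])
         apply (simp_all add: eq)
        done
    qed
  qed
qed

text \<open>It suffices to give two rim vertices at distance two the same color; by rotation these
  may be taken as \<open>A0\<close> and \<open>A2\<close>.\<close>

lemma ico_reach_base:
  assumes c: "proper_coloring V ico_adj l c" and V: "ico_wheel \<subseteq> V" and l: "5 \<le> l"
  shows "recolor_reach V ico_adj l c ico_base"
proof -
  note rot = ico_reach_base_rotI[OF _ _ l]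
  have 1: "recolor_reach V ico_adj l c ico_base"
    if "proper_coloring V ico_adj l c" "ico_wheel \<subseteq> V" "c A1 = c A3" for V c
    by (rule rot[OF that(1,2)], rule ico_reach_base_02[OF _ _ l]) (simp_all add: that)
  have 2: "recolor_reach V ico_adj l c ico_base"
    if "proper_coloring V ico_adj l c" "ico_wheel \<subseteq> V" "c A2 = c A4" for V c
    by (rule rot[OF that(1,2)], rule 1) (simp_all add: that)
  have 3: "recolor_reach V ico_adj l c ico_base"
    if "proper_coloring V ico_adj l c" "ico_wheel \<subseteq> V" "c A3 = c A0" for V c
    by (rule rot[OF that(1,2)], rule 2) (simp_all add: that)
  have 4: "recolor_reach V ico_adj l c ico_base"
    if "proper_coloring V ico_adj l c" "ico_wheel \<subseteq> V" "c A4 = c A1" for V c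
    by (rule rot[OF that(1,2)], rule 3) (simp_all add: that)
  note ne = ico_proper_inner[OF c V]
  note out = ico_proper_outer[OF c V]
  note nes = ne ne[symmetric] out
  have rng: "c A2 \<in> {1..l}" "c A4 \<in> {1..l}"
    using V proper_coloring_range[OF c] by auto
  show ?thesis
  proof (cases "c A2 = c A4")
    case True
    then show ?thesis using c V 2 by blast
  next
    case False
    note F = False False[symmetric]
    show ?thesis
    \<comment> \<open>Only \<open>B3\<close> can keep \<open>A0\<close> from taking the color of
      \<open>A2\<close>, as \<open>B0\<close> and \<open>B2\<close> are adjacent to
      \<open>A2\<close>. If it does, then by its color it cannot keep \<open>A1\<close> from taking
      the color of \<open>A4\<close>.\<close>
    proof (cases "B3 \<in> V \<and> c B3 = c A2")
      case True
      show ?thesis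
        by (rule ico_reach_upd_trans[OF c rng(2), of A1]; (rule 4)?)
          (use V in \<open>simp_all add: nes F True\<close>)
    next
      case b3: False
      then have b3: "B3 \<in> V \<Longrightarrow> c B3 \<noteq> c A2" by blast
      show ?thesis
        by (rule ico_reach_upd_trans[OF c rng(1), of A0]; (rule ico_reach_base_02)?)
          (use V l in \<open>simp_all add: nes F b3\<close>)
    qed
  qed
qed

lemma ico_connected:
  assumes "ico_wheel \<subseteq> V" "5 \<le> l"
    and "proper_coloring V ico_adj l c" "proper_coloring V ico_adj l d"
  shows "recolor_reach V ico_adj l c d"
  using assms ico_reach_base by (meson recolor_reach_sym rtranclp_trans)

section \<open>Structure around an induced wheel\<close>

definition induced_C5 :: "('a \<Rightarrow> 'a \<Rightarrow> bool) \<Rightarrow> 'a \<Rightarrow> 'a \<Rightarrow> 'a \<Rightarrow> 'a \<Rightarrow> 'a \<Rightarrow> bool" where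
  "induced_C5 E p q r s t \<longleftrightarrow>
     E p q \<and> E q r \<and> E r s \<and> E s t \<and> E t p \<and>
     \<not> E p r \<and> \<not> E q s \<and> \<not> E r t \<and> \<not> E s p \<and> \<not> E t q"

text \<open>The wheel is addressed by the names of the classes, so that rotating it is composition
  with \<open>ico_rot\<close>; \<open>h\<close> is constrained on \<open>ico_wheel\<close>
  only.\<close>

locale wheel_graph =
  fixes V :: "'a set" and E :: "'a \<Rightarrow> 'a \<Rightarrow> bool" and h :: "ico \<Rightarrow> 'a"
  assumes finite_V: "finite V"
    and E_comm: "E x y \<longleftrightarrow> E y x"
    and E_irrefl: "\<not> E x x"
    and E_V: "E x y \<Longrightarrow> x \<in> V"
    and two_K2_free: "E a b \<Longrightarrow> E c d \<Longrightarrow> E a c \<or> E a d \<or> E b c \<or> E b d"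
    and K4_free: "E a b \<Longrightarrow> E a c \<Longrightarrow> E a d \<Longrightarrow> E b c \<Longrightarrow> E b d \<Longrightarrow> \<not> E c d"
    and H4_free: "induced_C5 E p q r s t \<Longrightarrow> E x p \<Longrightarrow> E x q \<Longrightarrow> E x r \<Longrightarrow> E x s \<Longrightarrow> E x t"
    and wheel: "i \<in> ico_wheel \<Longrightarrow> j \<in> ico_wheel \<Longrightarrow> E (h i) (h j) \<longleftrightarrow> ico_adj i j"
begin

section \<open>Classes by neighbours on the rim\<close>

definition cls :: "ico \<Rightarrow> 'a \<Rightarrow> bool" where
  "cls i x \<longleftrightarrow> (\<forall>k\<in>ico_rim. E x (h k) \<longleftrightarrow> ico_adj i k)"

text \<open>Rotation produces another instance of the locale, which carries facts about
  \<open>A0\<close> or \<open>B0\<close> to the whole orbit.\<close>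

lemma wheel_rot: "wheel_graph V E (h \<circ> ico_rot)"
proof
  show "E ((h \<circ> ico_rot) i) ((h \<circ> ico_rot) j) \<longleftrightarrow> ico_adj i j"
    if "i \<in> ico_wheel" "j \<in> ico_wheel" for i j
  proof -
    have "ico_rot i \<in> ico_wheel" "ico_rot j \<in> ico_wheel" using that by auto
    then show ?thesis by (simp add: wheel ico_adj_rot)
  qed
qed (fact finite_V E_comm E_irrefl E_V two_K2_free K4_free H4_free)+

lemma cycle:
  "E (h A0) (h A1)" "E (h A1) (h A2)" "E (h A2) (h A3)" "E (h A3) (h A4)" "E (h A4) (h A0)"
  "\<not> E (h A0) (h A2)" "\<not> E (h A1) (h A3)" "\<not> E (h A2) (h A4)" "\<not> E (h A3) (h A0)" "\<not> E (h A4) (h A1)"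
  "E (h HU) (h A0)" "E (h HU) (h A1)" "E (h HU) (h A2)" "E (h HU) (h A3)" "E (h HU) (h A4)"
  by (simp_all add: wheel ico_adj_def)

lemma cls_simps:
  shows "cls A0 x \<longleftrightarrow> \<not> E x (h A0) \<and> E x (h A1) \<and> \<not> E x (h A2) \<and> \<not> E x (h A3) \<and> E x (h A4)"
    and "cls A1 x \<longleftrightarrow> E x (h A0) \<and> \<not> E x (h A1) \<and> E x (h A2) \<and> \<not> E x (h A3) \<and> \<not> E x (h A4)"
    and "cls A2 x \<longleftrightarrow> \<not> E x (h A0) \<and> E x (h A1) \<and> \<not> E x (h A2) \<and> E x (h A3) \<and> \<not> E x (h A4)"
    and "cls A3 x \<longleftrightarrow> \<not> E x (h A0) \<and> \<not> E x (h A1) \<and> E x (h A2) \<and> \<not> E x (h A3) \<and> E x (h A4)"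
    and "cls A4 x \<longleftrightarrow> E x (h A0) \<and> \<not> E x (h A1) \<and> \<not> E x (h A2) \<and> E x (h A3) \<and> \<not> E x (h A4)"
    and "cls B0 x \<longleftrightarrow> E x (h A0) \<and> \<not> E x (h A1) \<and> E x (h A2) \<and> E x (h A3) \<and> \<not> E x (h A4)"
    and "cls B1 x \<longleftrightarrow> \<not> E x (h A0) \<and> E x (h A1) \<and> \<not> E x (h A2) \<and> E x (h A3) \<and> E x (h A4)"
    and "cls B2 x \<longleftrightarrow> E x (h A0) \<and> \<not> E x (h A1) \<and> E x (h A2) \<and> \<not> E x (h A3) \<and> E x (h A4)"
    and "cls B3 x \<longleftrightarrow> E x (h A0) \<and> E x (h A1) \<and> \<not> E x (h A2) \<and> E x (h A3) \<and> \<not> E x (h A4)"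
    and "cls B4 x \<longleftrightarrow> \<not> E x (h A0) \<and> E x (h A1) \<and> E x (h A2) \<and> \<not> E x (h A3) \<and> E x (h A4)"
    and "cls HU x \<longleftrightarrow> E x (h A0) \<and> E x (h A1) \<and> E x (h A2) \<and> E x (h A3) \<and> E x (h A4)"
    and "cls HZ x \<longleftrightarrow> \<not> E x (h A0) \<and> \<not> E x (h A1) \<and> \<not> E x (h A2) \<and> \<not> E x (h A3) \<and> \<not> E x (h A4)"
  by (auto simp: cls_def ico_adj_def)

lemma cls_rot: "wheel_graph.cls E (h \<circ> ico_rot) i x \<longleftrightarrow> cls (ico_rot i) x"
  by (cases i) (simp_all only: ico_rot.simps cls_simps wheel_graph.cls_simps[OF wheel_rot]
      comp_apply conj_ac)

text \<open>\<open>r s\<close> is the edge of the 5-cycle opposite to \<open>p\<close>; if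
  \<open>x\<close> missed both its ends, \<open>x p\<close> and \<open>r s\<close> would be an
  induced \<open>2K2\<close>.\<close>

lemma attach: "induced_C5 E p q r s t \<Longrightarrow> E x p \<Longrightarrow> E x r \<or> E x s"
  unfolding induced_C5_def using two_K2_free[of x p r s] E_comm by blast

lemma cls_hub: "cls HU (h HU)"
  by (simp add: cls_def wheel)

lemma cls_rim: "i \<in> ico_rim \<Longrightarrow> cls i (h i)"
  by (auto simp: cls_def wheel)

lemma C5_rim: "induced_C5 E (h A0) (h A1) (h A2) (h A3) (h A4)"
  unfolding induced_C5_def using cycle by blast

text \<open>Opposite edges exclude a single rim neighbour, and two or three consecutive ones;
  \<open>H4\<close> excludes exactly four. A point outside \<open>V\<close> has no neighbours and
  counts as \<open>HZ\<close>.\<close>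

lemma cls_ex: "\<exists>i. cls i x"
proof -
  have rot: "induced_C5 E q r s t p" if "induced_C5 E p q r s t" for p q r s t
    using that by (auto simp: induced_C5_def)
  note c0 = C5_rim note c1 = rot[OF c0] note c2 = rot[OF c1] note c3 = rot[OF c2]
  note c4 = rot[OF c3]
  note at = attach[OF c0, of x] attach[OF c1, of x] attach[OF c2, of x] attach[OF c3, of x]
    attach[OF c4, of x]
  note h4 = H4_free[OF c0, of x] H4_free[OF c1, of x] H4_free[OF c2, of x] H4_free[OF c3, of x]
    H4_free[OF c4, of x]
  have "cls A0 x \<or> cls A1 x \<or> cls A2 x \<or> cls A3 x \<or> cls A4 x \<or> cls B0 x \<or> cls B1 x \<or> cls B2 x
    \<or> cls B3 x \<or> cls B4 x \<or> cls HU x \<or> cls HZ x"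
    unfolding cls_simps using at h4 by argo
  then show ?thesis by blast
qed

section \<open>Adjacency between the classes\<close>

definition adj_determined :: "ico \<Rightarrow> ico \<Rightarrow> bool" where
  "adj_determined i j \<longleftrightarrow> (\<forall>x y. cls i x \<longrightarrow> cls j y \<longrightarrow> (E x y \<longleftrightarrow> ico_adj i j))"

lemma adj_determined_comm: "adj_determined i j \<Longrightarrow> adj_determined j i"
  unfolding adj_determined_def using E_comm symp_ico_adj by (metis sympD)

lemma adj_determined_rot:
  "wheel_graph.adj_determined E (h \<circ> ico_rot) i j \<Longrightarrow> adj_determined (ico_rot i) (ico_rot j)"
  unfolding adj_determined_def wheel_graph.adj_determined_def[OF wheel_rot] cls_rot ico_adj_rot .

text \<open>A vertex of class \<open>A0\<close> can stand in for \<open>h A0\<close> on the rim,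
  which supplies new 5-cycles to which the forbidden subgraphs apply.\<close>

lemma C5_replace:
  assumes "cls A0 x"
  shows "induced_C5 E (h A1) (h A2) (h A3) (h A4) x" "induced_C5 E (h A2) (h A3) (h A4) x (h A1)"
    "induced_C5 E (h A3) (h A4) x (h A1) (h A2)" "induced_C5 E (h A4) x (h A1) (h A2) (h A3)"
    "induced_C5 E x (h A1) (h A2) (h A3) (h A4)"
  using assms cycle E_comm unfolding induced_C5_def cls_simps by blast+

lemma adj_determinedI:
  "(\<And>x y. cls i x \<Longrightarrow> cls j y \<Longrightarrow> E x y \<longleftrightarrow> ico_adj i j) \<Longrightarrow> adj_determined i j"
  by (simp add: adj_determined_def)

lemma hub_A0: "cls A0 x \<Longrightarrow> cls HU y \<Longrightarrow> E y x"
  using H4_free[OF C5_replace(1), of x y] unfolding cls_simps by blast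

lemma det_A0_HU: "adj_determined A0 HU"
proof (rule adj_determinedI)
  fix x y assume "cls A0 x" "cls HU y"
  then have "E x y" using hub_A0 E_comm by blast
  then show "E x y \<longleftrightarrow> ico_adj A0 HU" by (simp add: ico_adj_def)
qed

lemma det_A0_A0: "adj_determined A0 A0"
proof (rule adj_determinedI)
  fix x y assume xy: "cls A0 x" "cls A0 y"
  have "E (h HU) x" "E (h HU) y" "E (h HU) (h A1)" using xy hub_A0 cls_hub cycle by blast+
  moreover have "E (h A1) x" "E (h A1) y" using xy E_comm unfolding cls_simps by blast+
  ultimately have "\<not> E x y" using K4_free by blast
  then show "E x y \<longleftrightarrow> ico_adj A0 A0" by (simp add: ico_adj_def)
qed

text \<open>Otherwise the edges from \<open>y\<close> to \<open>h A2\<close> and from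
  \<open>x\<close> to \<open>h A4\<close> would form a \<open>2K2\<close>.\<close>

lemma det_A0_A1: "adj_determined A0 A1"
proof (rule adj_determinedI)
  fix x y assume xy: "cls A0 x" "cls A1 y"
  have "E y (h A4) \<or> E y x"
    using attach[OF C5_replace(2)[OF xy(1)], of y] xy(2) unfolding cls_simps by blast
  then have "E x y" using xy(2) E_comm unfolding cls_simps by blast
  then show "E x y \<longleftrightarrow> ico_adj A0 A1" by (simp add: ico_adj_def)
qed

lemma hub_A:
  assumes "cls i x" "i \<in> ico_rim" "cls HU y"
  shows "E y x"
proof -
  interpret h1: wheel_graph V E "h \<circ> ico_rot" by (rule wheel_rot)
  interpret h2: wheel_graph V E "h \<circ> ico_rot \<circ> ico_rot" by (rule h1.wheel_rot)
  interpret h3: wheel_graph V E "h \<circ> ico_rot \<circ> ico_rot \<circ> ico_rot" by (rule h2.wheel_rot)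
  interpret h4: wheel_graph V E "h \<circ> ico_rot \<circ> ico_rot \<circ> ico_rot \<circ> ico_rot" by (rule h3.wheel_rot)
  note rots = cls_rot h1.cls_rot h2.cls_rot h3.cls_rot
  show ?thesis using assms hub_A0[of x y] h1.hub_A0[of x y] h2.hub_A0[of x y] h3.hub_A0[of x y]
      h4.hub_A0[of x y]
    by (auto simp: rots)
qed

lemma det_A0_A2: "adj_determined A0 A2"
proof (rule adj_determinedI)
  fix x y assume xy: "cls A0 x" "cls A2 y"
  have "E (h HU) x" "E (h HU) y" "E (h HU) (h A1)"
    using xy hub_A[OF _ _ cls_hub] cycle by blast+
  moreover have "E (h A1) x" "E (h A1) y" using xy E_comm unfolding cls_simps by blast+
  ultimately have "\<not> E x y" using K4_free by blast
  then show "E x y \<longleftrightarrow> ico_adj A0 A2" by (simp add: ico_adj_def)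
qed

lemma det_A0_HZ: "adj_determined A0 HZ"
proof (rule adj_determinedI)
  fix x y assume xy: "cls A0 x" "cls HZ y"
  have "\<not> E y x"
    using attach[OF C5_replace(5)[OF xy(1)], of y] xy(2) unfolding cls_simps by blast
  then show "E x y \<longleftrightarrow> ico_adj A0 HZ" using E_comm by (auto simp: ico_adj_def)
qed

lemma det_B0_HU: "adj_determined B0 HU"
proof (rule adj_determinedI)
  fix x y assume xy: "cls B0 x" "cls HU y"
  have "\<not> E x y"
    using K4_free[of "h A2" "h A3" x y] xy cycle E_comm unfolding cls_simps by blast
  then show "E x y \<longleftrightarrow> ico_adj B0 HU" by (simp add: ico_adj_def)
qed

lemma det_B0_A0: "adj_determined B0 A0"
proof (rule adj_determinedI)
  fix x y assume xy: "cls B0 x" "cls A0 y"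
  have "E x (h A4) \<or> E x y"
    using attach[OF C5_replace(2)[OF xy(2)], of x] xy(1) unfolding cls_simps by blast
  then have "E x y" using xy(1) unfolding cls_simps by blast
  then show "E x y \<longleftrightarrow> ico_adj B0 A0" by (simp add: ico_adj_def)
qed

text \<open>With \<open>y\<close> in place of \<open>h A1\<close>, an edge \<open>x y\<close> would
  give \<open>x\<close> exactly four neighbours on the new rim.\<close>

lemma det_B0_A1: "adj_determined B0 A1"
proof (rule adj_determinedI)
  fix x y assume xy: "cls B0 x" "cls A1 y"
  have "induced_C5 E (h A0) y (h A2) (h A3) (h A4)"
    using xy(2) cycle E_comm unfolding induced_C5_def cls_simps by blast
  from H4_free[OF this, of x] have "\<not> E x y" using xy(1) unfolding cls_simps by blast
  then show "E x y \<longleftrightarrow> ico_adj B0 A1" by (simp add: ico_adj_def)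
qed

lemma det_B0_A4: "adj_determined B0 A4"
proof (rule adj_determinedI)
  fix x y assume xy: "cls B0 x" "cls A4 y"
  have "induced_C5 E (h A2) (h A3) y (h A0) (h A1)"
    using xy(2) cycle E_comm unfolding induced_C5_def cls_simps by blast
  from H4_free[OF this, of x] have "\<not> E x y" using xy(1) unfolding cls_simps by blast
  then show "E x y \<longleftrightarrow> ico_adj B0 A4" by (simp add: ico_adj_def)
qed

text \<open>A non-adjacent pair would yield a second 5-cycle through \<open>x\<close>, seen by the hub in
  exactly four vertices.\<close>

lemma det_B0_A2: "adj_determined B0 A2"
proof (rule adj_determinedI)
  fix x y assume xy: "cls B0 x" "cls A2 y"
  have "\<not> E (h HU) x"
    using det_B0_HU xy(1) cls_hub E_comm by (auto simp: adj_determined_def ico_adj_def)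
  moreover have "E (h HU) y" using xy(2) hub_A[OF _ _ cls_hub] by blast
  moreover have "induced_C5 E (h A0) (h A1) y (h A3) x" if "\<not> E x y"
    using xy that cycle E_comm unfolding induced_C5_def cls_simps by blast
  ultimately have "E x y" using H4_free cycle by blast
  then show "E x y \<longleftrightarrow> ico_adj B0 A2" by (simp add: ico_adj_def)
qed

lemma det_B0_A3: "adj_determined B0 A3"
proof (rule adj_determinedI)
  fix x y assume xy: "cls B0 x" "cls A3 y"
  have "\<not> E (h HU) x"
    using det_B0_HU xy(1) cls_hub E_comm by (auto simp: adj_determined_def ico_adj_def)
  moreover have "E (h HU) y" using xy(2) hub_A[OF _ _ cls_hub] by blast
  moreover have "induced_C5 E (h A0) (h A4) y (h A2) x" if "\<not> E x y"
    using xy that cycle E_comm unfolding induced_C5_def cls_simps by blast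
  ultimately have "E x y" using H4_free cycle by blast
  then show "E x y \<longleftrightarrow> ico_adj B0 A3" by (simp add: ico_adj_def)
qed

lemma det_B0_B0: "adj_determined B0 B0"
proof (rule adj_determinedI)
  fix x y assume xy: "cls B0 x" "cls B0 y"
  have "\<not> E x y"
    using K4_free[of "h A2" "h A3" x y] xy cycle E_comm unfolding cls_simps by blast
  then show "E x y \<longleftrightarrow> ico_adj B0 B0" by (simp add: ico_adj_def)
qed

lemma det_B0_B1: "adj_determined B0 B1"
proof (rule adj_determinedI)
  fix x y assume xy: "cls B0 x" "cls B1 y"
  have "E x y"
    using two_K2_free[of x "h A2" y "h A4"] xy cycle E_comm unfolding cls_simps by blast
  then show "E x y \<longleftrightarrow> ico_adj B0 B1" by (simp add: ico_adj_def)
qed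

text \<open>Neither vertex sees \<open>h A1\<close> or the hub, so an edge \<open>x y\<close> would
  form a \<open>2K2\<close> with that spoke.\<close>

lemma det_B0_B2: "adj_determined B0 B2"
proof (rule adj_determinedI)
  fix x y assume xy: "cls B0 x" "cls B2 y"
  have "\<not> E (h HU) x" using det_B0_HU xy(1) cls_hub E_comm
    by (auto simp: adj_determined_def ico_adj_def)
  moreover have "\<not> E (h HU) y"
    using K4_free[of "h A4" "h A0" y "h HU"] xy(2) cycle E_comm unfolding cls_simps by blast
  ultimately have "\<not> E x y"
    using two_K2_free[of x y "h A1" "h HU"] xy cycle E_comm unfolding cls_simps by blast
  then show "E x y \<longleftrightarrow> ico_adj B0 B2" by (simp add: ico_adj_def)
qed

lemma det_HU_HU: "adj_determined HU HU"
proof (rule adj_determinedI)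
  fix x y assume xy: "cls HU x" "cls HU y"
  have "\<not> E x y"
    using K4_free[of "h A0" "h A1" x y] xy cycle E_comm unfolding cls_simps by blast
  then show "E x y \<longleftrightarrow> ico_adj HU HU" by (simp add: ico_adj_def)
qed

lemma det_HZ_HZ: "adj_determined HZ HZ"
proof (rule adj_determinedI)
  fix x y assume xy: "cls HZ x" "cls HZ y"
  have "\<not> E x y"
    using two_K2_free[of x y "h A0" "h A1"] xy cycle E_comm unfolding cls_simps by blast
  then show "E x y \<longleftrightarrow> ico_adj HZ HZ" by (simp add: ico_adj_def)
qed

end

text \<open>Rotation changes \<open>h\<close>, so the induction has to range over all embeddings and
  takes place outside the locale.\<close>

lemma adj_determined_orbit:
  assumes h: "wheel_graph V E h"
    and "\<And>h. wheel_graph V E h \<Longrightarrow> wheel_graph.adj_determined E h i j"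
  shows "wheel_graph.adj_determined E h ((ico_rot ^^ n) i) ((ico_rot ^^ n) j)"
  using h
proof (induction n arbitrary: h)
  case 0
  then show ?case using assms(2) by simp
next
  case (Suc n)
  have "wheel_graph.adj_determined E (h \<circ> ico_rot) ((ico_rot ^^ n) i) ((ico_rot ^^ n) j)"
    using Suc.IH[OF wheel_graph.wheel_rot[OF Suc.prems]] .
  from wheel_graph.adj_determined_rot[OF Suc.prems this] show ?case by simp
qed

lemma adj_determined_orbit5:
  assumes h: "wheel_graph V E h"
    and D: "\<And>h. wheel_graph V E h \<Longrightarrow> wheel_graph.adj_determined E h i j"
  defines "A \<equiv> wheel_graph.adj_determined E h" and "r \<equiv> ico_rot"
  shows "A i j" "A (r i) (r j)" "A (r (r i)) (r (r j))" "A (r (r (r i))) (r (r (r j)))"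
    "A (r (r (r (r i)))) (r (r (r (r j))))"
  using adj_determined_orbit[OF h D, of 0] adj_determined_orbit[OF h D, of 1]
    adj_determined_orbit[OF h D, of 2] adj_determined_orbit[OF h D, of 3]
    adj_determined_orbit[OF h D, of 4]
  by (simp_all add: A_def r_def numeral_eq_Suc)

context wheel_graph
begin

text \<open>The 66 unordered pairs of the eleven classes split under rotation into thirteen orbits
  of size five and the pair of \<open>HU\<close> with itself.\<close>

lemma adj_determined_all:
  assumes "i \<noteq> HZ" "j \<noteq> HZ"
  shows "adj_determined i j"
proof -
  note orbit = adj_determined_orbit5[OF wheel_graph_axioms, unfolded ico_rot.simps]
  note D = orbit[OF wheel_graph.det_A0_A0, unfolded ico_rot.simps]
    orbit[OF wheel_graph.det_A0_A1, unfolded ico_rot.simps]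
    orbit[OF wheel_graph.det_A0_A2, unfolded ico_rot.simps]
    orbit[OF wheel_graph.det_A0_HU, unfolded ico_rot.simps]
    orbit[OF wheel_graph.det_B0_A0, unfolded ico_rot.simps]
    orbit[OF wheel_graph.det_B0_A1, unfolded ico_rot.simps]
    orbit[OF wheel_graph.det_B0_A2, unfolded ico_rot.simps]
    orbit[OF wheel_graph.det_B0_A3, unfolded ico_rot.simps]
    orbit[OF wheel_graph.det_B0_A4, unfolded ico_rot.simps]
    orbit[OF wheel_graph.det_B0_B0, unfolded ico_rot.simps]
    orbit[OF wheel_graph.det_B0_B1, unfolded ico_rot.simps]
    orbit[OF wheel_graph.det_B0_B2, unfolded ico_rot.simps]
    orbit[OF wheel_graph.det_B0_HU, unfolded ico_rot.simps]
    det_HU_HU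
  show ?thesis using assms by (cases i; cases j) (simp_all add: D D[THEN adj_determined_comm])
qed

lemma adj_iff:
  "\<lbrakk>cls i x; cls j y; i \<noteq> HZ; j \<noteq> HZ\<rbrakk> \<Longrightarrow> E x y \<longleftrightarrow> ico_adj i j"
  using adj_determined_all by (simp add: adj_determined_def)

section \<open>Vertices without neighbours on the rim\<close>

lemma HZ_nbr:
  assumes "cls HZ z" "cls j y" "E z y"
  shows "j \<in> insert HU ico_ring"
proof -
  note orbit = adj_determined_orbit5[OF wheel_graph_axioms wheel_graph.det_A0_HZ,
      unfolded ico_rot.simps, THEN adj_determined_comm]
  have "\<not> adj_determined HZ j \<or> ico_adj HZ j"
    using assms by (auto simp: adj_determined_def)
  then show ?thesis
    using orbit det_HZ_HZ by (cases j) (simp_all add: ico_adj_def)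
qed

text \<open>Rim neighbourhoods of ring classes have three elements and that of \<open>HU\<close> has
  five, so some rim vertex is seen by class \<open>j\<close> and not by class \<open>i\<close>. Its
  edge to \<open>w\<close> is kept from forming a \<open>2K2\<close> with \<open>z b\<close> only by
  an edge \<open>z w\<close>.\<close>

lemma HZ_spread:
  assumes "cls HZ z" "E z b" "cls i b" "cls j w"
    and i: "i \<in> ico_ring" and j: "j \<in> insert HU ico_ring" and "i \<noteq> j" "\<not> ico_adj i j"
  shows "E z w"
proof -
  have "\<exists>k\<in>ico_rim. ico_adj j k \<and> \<not> ico_adj i k"
    using i j \<open>i \<noteq> j\<close> by (cases i; cases j; simp add: ico_adj_def)
  then obtain k where k: "k \<in> ico_rim" "ico_adj j k" "\<not> ico_adj i k" by blast
  have "\<not> E b w" using adj_iff[of i b j w] assms by auto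
  moreover have "\<not> E z (h k)" "\<not> E b (h k)" "E w (h k)"
    using assms(1,3,4) k by (auto simp: cls_def ico_adj_def)
  ultimately show ?thesis using two_K2_free[of z b w "h k"] assms(2) by blast
qed

text \<open>A vertex without neighbours on the rim may still have its neighbourhood contained in that
  of a rim vertex; it is then retracted to the rim, and only the other ones are sent to \<open>HZ\<close>.\<close>

definition dominated_by :: "ico \<Rightarrow> 'a \<Rightarrow> bool" where
  "dominated_by i z \<longleftrightarrow> i \<in> ico_rim \<and> (\<forall>j b. cls j b \<longrightarrow> E z b \<longrightarrow> ico_adj i j)"

definition dominated :: "'a \<Rightarrow> bool" where
  "dominated z \<longleftrightarrow> (\<exists>i. dominated_by i z)"

definition meets :: "'a \<Rightarrow> ico \<Rightarrow> bool" where
  "meets z j \<longleftrightarrow> (\<exists>b. cls j b \<and> E z b)"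

text \<open>Failing to lie below a rim vertex means having a neighbour in one of the two ring
  classes not adjacent to it. The five resulting pairs are exactly the nonadjacent pairs of the
  ring.\<close>

lemma meets_undominated:
  assumes "cls HZ z" "\<not> dominated z"
  shows "meets z B1 \<or> meets z B4" "meets z B2 \<or> meets z B0" "meets z B3 \<or> meets z B1"
    "meets z B4 \<or> meets z B2" "meets z B0 \<or> meets z B3"
proof -
  have *: "\<exists>j. meets z j \<and> j \<in> ico_ring \<and> \<not> ico_adj i j" if i: "i \<in> ico_rim" for i
  proof -
    obtain j b where jb: "cls j b" "E z b" "\<not> ico_adj i j"
      using assms(2) i unfolding dominated_def dominated_by_def by blast
    moreover have "j \<noteq> HU" using i jb(3) by (auto simp: ico_adj_def)
    ultimately show ?thesis using HZ_nbr[OF assms(1) jb(1,2)] unfolding meets_def by blast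
  qed
  show "meets z B1 \<or> meets z B4" using *[of A0] by (auto simp: ico_adj_def)
  show "meets z B2 \<or> meets z B0" using *[of A1] by (auto simp: ico_adj_def)
  show "meets z B3 \<or> meets z B1" using *[of A2] by (auto simp: ico_adj_def)
  show "meets z B4 \<or> meets z B2" using *[of A3] by (auto simp: ico_adj_def)
  show "meets z B0 \<or> meets z B3" using *[of A4] by (auto simp: ico_adj_def)
qed

lemma meets_spread:
  assumes "cls HZ z" "meets z i" "cls j w" "i \<in> ico_ring" "j \<in> insert HU ico_ring"
    "i \<noteq> j" "\<not> ico_adj i j"
  shows "E z w"
  using assms HZ_spread unfolding meets_def by blast

lemma undominated_HU:
  assumes "cls HZ z" "\<not> dominated z" "cls HU w"
  shows "E z w"
proof -
  obtain i where "meets z i" "i \<in> ico_ring" using meets_undominated(1)[OF assms(1,2)] by blast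
  then show ?thesis
    using meets_spread[OF assms(1) _ assms(3)] by (auto simp: ico_adj_def)
qed

text \<open>If \<open>z\<close> missed a nonempty class \<open>j\<close>, spreading would make it
  miss the ring classes not adjacent to \<open>j\<close> as well, but of a nonadjacent pair at least
  one is met.\<close>

lemma undominated_meets:
  assumes z: "cls HZ z" "\<not> dominated z" and w: "cls j w" "j \<in> ico_ring"
  shows "meets z j"
proof (rule ccontr)
  assume n: "\<not> meets z j"
  then have "\<not> E z w" using w(1) by (auto simp: meets_def)
  then have "\<not> meets z i" if "i \<in> ico_ring" "i \<noteq> j" "\<not> ico_adj i j" for i
    using meets_spread[OF z(1) _ w(1)] that w(2) by blast
  from this[of B0] this[of B1] this[of B2] this[of B3] this[of B4]
  show False using w(2) n meets_undominated[OF z] by (auto simp: ico_adj_def)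
qed

text \<open>Here \<open>j, m, n, k\<close> is a path of nonadjacent ring classes. Spreading shows
  that \<open>z'\<close> misses \<open>m\<close> and \<open>z\<close> misses \<open>n\<close>, so
  \<open>z\<close> meets \<open>m\<close> and \<open>z'\<close> meets \<open>n\<close>; spreading
  from \<open>n\<close> to \<open>m\<close> then contradicts the former.\<close>

lemma undominated_nested_aux:
  assumes z: "cls HZ z" "\<not> dominated z" and z': "cls HZ z'" "\<not> dominated z'"
    and j: "cls j b" "j \<in> ico_ring" "\<not> E z' b" and k: "cls k b'" "k \<in> ico_ring" "\<not> E z b'"
    and m: "m \<in> ico_ring" "m \<noteq> j" "\<not> ico_adj m j" and n: "n \<in> ico_ring" "n \<noteq> k" "\<not> ico_adj n k"
    and mn: "n \<noteq> m" "\<not> ico_adj n m"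
    and or: "meets z m \<or> meets z n" "meets z' m \<or> meets z' n"
  shows False
proof -
  have "\<not> meets z' m" using meets_spread[OF z'(1) _ j(1)] j m by blast
  moreover have "\<not> meets z n" using meets_spread[OF z(1) _ k(1)] k n by blast
  ultimately have *: "meets z m" "meets z' n" using or by auto
  then obtain w where "cls m w" by (auto simp: meets_def)
  then have "E z' w" using meets_spread[OF z'(1) *(2)] m n mn by blast
  with \<open>cls m w\<close> \<open>\<not> meets z' m\<close> show False by (auto simp: meets_def)
qed

text \<open>Private neighbours of \<open>z\<close> and \<open>z'\<close> must be adjacent by
  \<open>2K2\<close>-freeness, so they lie in adjacent ring classes, and such classes are always the
  ends of a path as in \<open>undominated_nested_aux\<close>.\<close>

lemma undominated_nested:
  assumes z: "cls HZ z" "\<not> dominated z" and z': "cls HZ z'" "\<not> dominated z'"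
  shows "{x. E x z} \<subseteq> {x. E x z'} \<or> {x. E x z'} \<subseteq> {x. E x z}"
proof (rule ccontr)
  assume "\<not> ?thesis"
  then obtain b b' where b: "E z b" "\<not> E z' b" and b': "E z' b'" "\<not> E z b'"
    using E_comm by blast
  obtain j k where jk: "cls j b" "cls k b'" using cls_ex by blast
  have "j \<noteq> HU" "k \<noteq> HU" using undominated_HU z z' b b' jk by blast+
  then have ring: "j \<in> ico_ring" "k \<in> ico_ring"
    using HZ_nbr[OF z(1) jk(1) b(1)] HZ_nbr[OF z'(1) jk(2) b'(1)] by auto
  have "\<not> E z z'" using det_HZ_HZ z z' by (simp add: adj_determined_def ico_adj_def)
  then have "E b b'" using two_K2_free[OF b(1) b'(1)] b b' E_comm by blast
  then have adj: "ico_adj j k" using adj_iff[OF jk] ring by auto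
  note aux = undominated_nested_aux[OF z z' jk(1) ring(1) b(2) jk(2) ring(2) b'(2)]
  have ex: "\<exists>m\<in>ico_ring. \<exists>n\<in>ico_ring. m \<noteq> j \<and> \<not> ico_adj m j \<and> n \<noteq> k \<and> \<not> ico_adj n k
    \<and> n \<noteq> m \<and> \<not> ico_adj n m"
    using ring adj by (cases j; cases k; simp add: ico_adj_def)
  have or: "meets y m \<or> meets y n" if "cls HZ y" "\<not> dominated y" "m \<in> ico_ring" "n \<in> ico_ring"
    "n \<noteq> m" "\<not> ico_adj n m" for y m n
    using that(3-6) meets_undominated[OF that(1,2)] by (cases m; cases n; simp add: ico_adj_def disj_commute)
  show False using ex aux or z z' by blast
qed

text \<open>Outside \<open>HZ\<close> the class alone decides adjacency, so private neighbours of
  \<open>x\<close> and \<open>y\<close> both lie in \<open>HZ\<close>. As \<open>HZ\<close> is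
  independent, they would give a \<open>2K2\<close>.\<close>

lemma same_class_nested:
  assumes i: "i \<in> insert HU ico_ring" and x: "cls i x" and y: "cls i y"
  shows "{v. E v x} \<subseteq> {v. E v y} \<or> {v. E v y} \<subseteq> {v. E v x}"
proof (rule ccontr)
  assume "\<not> ?thesis"
  then obtain p q where p: "E p x" "\<not> E p y" and q: "E q y" "\<not> E q x" by blast
  obtain j k where jk: "cls j p" "cls k q" using cls_ex by blast
  have iz: "i \<noteq> HZ" using i by auto
  have "j = HZ" using adj_iff[OF jk(1) x _ iz] adj_iff[OF jk(1) y _ iz] p by blast
  moreover have "k = HZ" using adj_iff[OF jk(2) x _ iz] adj_iff[OF jk(2) y _ iz] q by blast
  ultimately have "\<not> E p q" using det_HZ_HZ jk by (simp add: adj_determined_def ico_adj_def)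
  moreover have "\<not> E x y"
    using adj_iff[OF x y iz iz] irreflp_ico_adj by (auto simp: irreflp_def)
  ultimately show False using two_K2_free[OF p(1) q(1)] p q E_comm by blast
qed

lemma cls_unique:
  assumes "cls i x" "cls j x"
  shows "i = j"
proof -
  have "\<forall>k\<in>ico_rim. ico_adj i k \<longleftrightarrow> ico_adj j k" using assms by (auto simp: cls_def)
  then show ?thesis by (cases i; cases j) (simp_all add: ico_adj_def)
qed

end

lemma finite_nested_max:
  assumes "finite F" "F \<noteq> {}" "\<And>x y. x \<in> F \<Longrightarrow> y \<in> F \<Longrightarrow> N x \<subseteq> N y \<or> N y \<subseteq> N x"
  shows "\<exists>s\<in>F. \<forall>y\<in>F. N y \<subseteq> N s"
  using assms
proof (induction rule: finite_ne_induct)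
  case (singleton x)
  then show ?case by auto
next
  case (insert x F)
  then obtain s where s: "s \<in> F" "\<forall>y\<in>F. N y \<subseteq> N s" by (metis insertCI)
  show ?case
  proof (cases "N x \<subseteq> N s")
    case True
    with s show ?thesis by auto
  next
    case False
    then have "N s \<subseteq> N x" using insert.prems[of x s] s(1) by auto
    with s show ?thesis by blast
  qed
qed

context wheel_graph
begin

section \<open>The retraction\<close>

definition proj :: "'a \<Rightarrow> ico" where
  "proj x = (if cls HZ x \<and> dominated x then (SOME i. dominated_by i x) else (SOME i. cls i x))"

lemma proj_dominated: "cls HZ x \<Longrightarrow> dominated x \<Longrightarrow> dominated_by (proj x) x"
  unfolding proj_def dominated_def by (auto intro: someI_ex)

lemma proj_cls: "\<not> (cls HZ x \<and> dominated x) \<Longrightarrow> cls (proj x) x"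
  unfolding proj_def by (auto intro: someI_ex[OF cls_ex])

lemma proj_eqI: "cls i x \<Longrightarrow> i \<noteq> HZ \<Longrightarrow> proj x = i"
  by (metis cls_unique proj_cls)

lemma proj_notin_rim: "proj x \<notin> ico_rim \<Longrightarrow> cls (proj x) x"
  using proj_cls proj_dominated unfolding dominated_by_def by blast

lemma proj_HZ:
  assumes "proj x = HZ"
  shows "cls HZ x" "\<not> dominated x"
proof -
  show c: "cls HZ x" using proj_notin_rim[of x] assms by simp
  show "\<not> dominated x" using proj_dominated[OF c] assms unfolding dominated_by_def by auto
qed

lemma proj_hom:
  assumes "E x y"
  shows "ico_adj (proj x) (proj y)"
proof -
  have main: "ico_adj (proj a) (proj b)" if ab: "E a b" and b: "\<not> cls HZ b" for a b
  proof -
    have cb: "cls (proj b) b" "proj b \<noteq> HZ" using proj_cls[of b] b by auto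
    show ?thesis
    proof (cases "cls HZ a")
      case True
      show ?thesis
      proof (cases "dominated a")
        case dom: True
        then show ?thesis using proj_dominated[OF True] cb ab unfolding dominated_by_def by blast
      next
        case False
        then have "proj a = HZ" using proj_cls[of a] True cls_unique by blast
        then show ?thesis using HZ_nbr[OF True cb(1) ab] by (auto simp: ico_adj_def)
      qed
    next
      case False
      then have "cls (proj a) a" "proj a \<noteq> HZ" using proj_cls[of a] by auto
      then show ?thesis using adj_iff cb ab by blast
    qed
  qed
  have "\<not> (cls HZ x \<and> cls HZ y)"
    using det_HZ_HZ assms by (auto simp: adj_determined_def ico_adj_def)
  then show ?thesis using main[of x y] main[of y x] assms E_comm sympD[OF symp_ico_adj] by blast
qed

lemma rim_V: "i \<in> ico_wheel \<Longrightarrow> h i \<in> V"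
  using E_V[OF cycle(1)] E_V[OF cycle(2)] E_V[OF cycle(3)] E_V[OF cycle(4)] E_V[OF cycle(5)]
    E_V[OF cycle(11)] by auto

lemma proj_rim: "i \<in> ico_wheel \<Longrightarrow> proj (h i) = i"
  using proj_eqI[OF cls_rim] proj_eqI[OF cls_hub] by auto

text \<open>Over a rim index the fibre also contains dominated vertices of \<open>HZ\<close>, and
  \<open>h i\<close> itself has the largest neighbourhood. Over any other index the neighbourhoods
  form a chain, and a largest one is taken.\<close>

lemma rep_ex:
  assumes "i \<in> proj ` V"
  shows "\<exists>s\<in>V. cls i s \<and> (i = HZ \<longrightarrow> \<not> dominated s) \<and> (\<forall>y\<in>V. proj y = i \<longrightarrow> {x. E x y} \<subseteq> {x. E x s})"
proof (cases "i \<in> ico_rim")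
  case True
  have "{x. E x y} \<subseteq> {x. E x (h i)}" if y: "proj y = i" for y
  proof
    fix x assume "x \<in> {x. E x y}"
    then have xy: "E x y" by simp
    obtain j where j: "cls j x" using cls_ex by blast
    have "ico_adj i j \<and> j \<noteq> HZ"
    proof (cases "cls HZ y \<and> dominated y")
      case d: True
      then have "dominated_by i y" using proj_dominated y by blast
      then have "ico_adj i j" using j xy E_comm unfolding dominated_by_def by blast
      then show ?thesis using True by (auto simp: ico_adj_def)
    next
      case False
      then have c: "cls i y" using proj_cls y by blast
      have "j \<noteq> HZ" using HZ_nbr[of x i y] xy c j True by auto
      then show ?thesis using adj_iff[OF c j] xy E_comm True by auto
    qed
    moreover from this have "E (h i) x" using adj_iff[OF cls_rim[OF True] j] True by auto
    ultimately show "x \<in> {x. E x (h i)}" using E_comm by blast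
  qed
  then show ?thesis using True rim_V[of i] cls_rim[OF True]
    by (intro bexI[of _ "h i"]) auto
next
  case False
  let ?F = "{y\<in>V. proj y = i}"
  have "\<exists>s\<in>?F. \<forall>y\<in>?F. {x. E x y} \<subseteq> {x. E x s}"
  proof (rule finite_nested_max)
    show "finite ?F" "?F \<noteq> {}" using finite_V assms by auto
    fix x y assume "x \<in> ?F" "y \<in> ?F"
    then have xy: "proj x = i" "proj y = i" by auto
    then have c: "cls i x" "cls i y" using False proj_notin_rim[of x] proj_notin_rim[of y] by auto
    show "{v. E v x} \<subseteq> {v. E v y} \<or> {v. E v y} \<subseteq> {v. E v x}"
    proof (cases "i = HZ")
      case True
      then show ?thesis using undominated_nested proj_HZ xy by blast
    next
      case nz: False
      have "i \<in> insert HU ico_ring" using nz False by (cases i) auto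
      then show ?thesis using same_class_nested c by blast
    qed
  qed
  then show ?thesis using False proj_notin_rim proj_HZ by fastforce
qed

lemma recolor_connected:
  assumes l: "5 \<le> l" and c: "proper_coloring V E l c" and d: "proper_coloring V E l d"
  shows "\<exists>d'. recolor_reach V E l c d' \<and> (\<forall>x\<in>V. d' x = d x)"
proof -
  obtain \<sigma> where \<sigma>: "\<And>i. i \<in> proj ` V \<Longrightarrow> \<sigma> i \<in> V" "\<And>i. i \<in> proj ` V \<Longrightarrow> cls i (\<sigma> i)"
    "HZ \<in> proj ` V \<Longrightarrow> \<not> dominated (\<sigma> HZ)"
    "\<And>i y. i \<in> proj ` V \<Longrightarrow> y \<in> V \<Longrightarrow> proj y = i \<Longrightarrow> {x. E x y} \<subseteq> {x. E x (\<sigma> i)}"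
    using rep_ex by metis
  have HZ: "E (\<sigma> HZ) (\<sigma> j)" if "HZ \<in> proj ` V" "j \<in> proj ` V" "ico_adj HZ j" for j
  proof (cases "j = HU")
    case True
    then show ?thesis using undominated_HU \<sigma> that by blast
  next
    case False
    then have j: "j \<in> ico_ring" using that(3) by (auto simp: ico_adj_def)
    \<comment> \<open>Some vertex of class \<open>j\<close> is a neighbour of the representative of
      \<open>HZ\<close>; the representative of \<open>j\<close>, having the largest neighbourhood in
      its fibre, is then a neighbour too.\<close>
    have "meets (\<sigma> HZ) j"
      using undominated_meets[OF \<sigma>(2)[OF that(1)] \<sigma>(3)[OF that(1)] \<sigma>(2)[OF that(2)] j] .
    then obtain b where b: "cls j b" "E (\<sigma> HZ) b" unfolding meets_def by blast
    have "b \<in> V" using E_V b(2) E_comm by blast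
    moreover have "proj b = j" using proj_eqI[OF b(1)] j by auto
    ultimately show ?thesis using \<sigma>(4)[OF that(2)] b(2) by blast
  qed
  show ?thesis
  proof (rule recolor_reach_retract[of V E proj "proj ` V" \<sigma> ico_adj l])
    show "ico_adj (proj x) (proj y)" if "E x y" for x y using proj_hom[OF that] .
    show "E x (\<sigma> (proj y))" if "y \<in> V" "E x y" for x y using \<sigma>(4)[of "proj y" y] that by auto
    show "E (\<sigma> i) (\<sigma> j)" if ij: "i \<in> proj ` V" "j \<in> proj ` V" "ico_adj i j" for i j
    proof (cases "i = HZ \<or> j = HZ")
      case True
      then show ?thesis using HZ[of i] HZ[of j] ij E_comm sympD[OF symp_ico_adj] by blast
    next
      case False
      then show ?thesis using adj_iff \<sigma>(2) ij by blast
    qed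
    show "recolor_reach (proj ` V) ico_adj l c d"
      if "proper_coloring (proj ` V) ico_adj l c" "proper_coloring (proj ` V) ico_adj l d" for c d
    proof (rule ico_connected[OF _ l that])
      show "ico_wheel \<subseteq> proj ` V" using proj_rim rim_V by (metis image_eqI subsetI)
    qed
  qed (use finite_V \<sigma>(1) c d E_comm in \<open>auto intro: sympI\<close>)
qed

end

section \<open>From digraphs to adjacency relations\<close>

lemma contains_induced_graph_onI:
  assumes G: "graph G" and inj: "inj_on f {..<n}" and V: "f ` {..<n} \<subseteq> verts G"
    and R: "R \<subseteq> {..<n} \<times> {..<n}"
    and adj: "\<And>i j. i < n \<Longrightarrow> j < n \<Longrightarrow> f i \<rightarrow>\<^bsub>G\<^esub> f j \<longleftrightarrow> (i, j) \<in> symcl R"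
  shows "contains_induced G (graph_on n R)"
proof -
  interpret graph G by fact
  let ?H = "G \<restriction> (f ` {..<n})"
  define g where "g = the_inv_into {..<n} f"
  have gf: "g (f i) = i" if "i < n" for i
    using that inj by (simp add: g_def the_inv_into_f_f)
  have fg: "f (g x) = x" "g x < n" if "x \<in> f ` {..<n}" for x
    using that gf by auto
  \<comment> \<open>Arcs of \<open>graph_on\<close> are pairs, so an arc goes to the labels of its
    ends; this is injective because there are no parallel arcs.\<close>
  define m where "m = \<lparr>iso_verts = g, iso_arcs = (\<lambda>e. (g (tail G e), g (head G e))),
     iso_head = snd, iso_tail = fst\<rparr>"
  have arcs: "(\<lambda>e. (g (tail G e), g (head G e))) ` arcs ?H = symcl R"
  proof (intro equalityI subsetI)
    fix p assume "p \<in> (\<lambda>e. (g (tail G e), g (head G e))) ` arcs ?H"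
    then obtain e where e: "e \<in> arcs G" "tail G e \<in> f ` {..<n}" "head G e \<in> f ` {..<n}"
      "p = (g (tail G e), g (head G e))" by auto
    then have "f (g (tail G e)) \<rightarrow>\<^bsub>G\<^esub> f (g (head G e))"
      by (simp add: fg arcs_ends_conv)
    then show "p \<in> symcl R" using adj e fg(2) by simp
  next
    fix p assume p: "p \<in> symcl R"
    obtain i j where ij: "p = (i, j)" by (cases p)
    have lt: "i < n" "j < n" using p R unfolding ij symcl_def by auto
    then have "(f i, f j) \<in> arcs_ends G" using adj p ij by simp
    then obtain e where "e \<in> arcs G" "tail G e = f i" "head G e = f j"
      by (auto simp: arcs_ends_conv)
    then show "p \<in> (\<lambda>e. (g (tail G e), g (head G e))) ` arcs ?H"
      using lt gf ij by (intro image_eqI[of _ _ e]) auto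
  qed
  have "graph_on n R = app_iso m ?H"
    using arcs gf by (auto simp: graph_on_def with_proj_def app_iso_def m_def image_image)
  moreover have "pre_digraph.digraph_isomorphism ?H m"
    unfolding pre_digraph.digraph_isomorphism_def
  proof (intro conjI ballI)
    show "wf_digraph ?H" by (rule wellformed_induce_subgraph)
    show "inj_on (iso_verts m) (verts ?H)" using gf by (auto simp: m_def inj_on_def)
    show "inj_on (iso_arcs m) (arcs ?H)"
    proof (rule inj_onI)
      fix a b assume ab: "a \<in> arcs ?H" "b \<in> arcs ?H" "iso_arcs m a = iso_arcs m b"
      then have "g (tail G a) = g (tail G b)" "g (head G a) = g (head G b)"
        by (simp_all add: m_def)
      moreover have "tail G a \<in> f ` {..<n}" "head G a \<in> f ` {..<n}"
        "tail G b \<in> f ` {..<n}" "head G b \<in> f ` {..<n}" using ab by auto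
      ultimately have "tail G a = tail G b" "head G a = head G b" by (metis fg(1))+
      moreover have "a \<in> arcs G" "b \<in> arcs G" using ab by auto
      ultimately show "a = b" using no_multi_arcs by (auto simp: arc_to_ends_def)
    qed
  qed (simp_all add: m_def)
  ultimately show ?thesis
    unfolding contains_induced_def digraph_iso_def using induced_induce[OF V] by blast
qed

lemma contains_induced_graph_onE:
  assumes "contains_induced G (graph_on n R)"
  obtains f where "f ` {..<n} \<subseteq> verts G"
    "\<And>i j. i < n \<Longrightarrow> j < n \<Longrightarrow> f i \<rightarrow>\<^bsub>G\<^esub> f j \<longleftrightarrow> (i, j) \<in> symcl R"
proof -
  obtain H m where H: "induced_subgraph H G" and iso: "pre_digraph.digraph_isomorphism H m"
    and eq: "graph_on n R = app_iso m H"
    using assms unfolding contains_induced_def digraph_iso_def by blast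
  have inj: "inj_on (iso_verts m) (verts H)" and wf: "wf_digraph H"
    and th: "\<And>a. a \<in> arcs H \<Longrightarrow> iso_verts m (tail H a) = iso_tail m (iso_arcs m a)
      \<and> iso_verts m (head H a) = iso_head m (iso_arcs m a)"
    using iso by (auto simp: pre_digraph.digraph_isomorphism_def)
  have V: "iso_verts m ` verts H = {..<n}" and A: "iso_arcs m ` arcs H = symcl R"
    and T: "iso_tail m = fst" and D: "iso_head m = snd"
    using eq by (auto simp: graph_on_def with_proj_def app_iso_def)
  have GH: "tail H = tail G" "head H = head G" "verts H \<subseteq> verts G"
    "arcs H = {e \<in> arcs G. tail G e \<in> verts H \<and> head G e \<in> verts H}"
    using H by (auto simp: induced_subgraph_def subgraph_def compatible_def)
  define f where "f = the_inv_into (verts H) (iso_verts m)"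
  have f: "f i \<in> verts H" "iso_verts m (f i) = i" if "i < n" for i
    using that V inj by (auto simp: f_def the_inv_into_into f_the_inv_into_f)
  have "f i \<rightarrow>\<^bsub>G\<^esub> f j \<longleftrightarrow> (i, j) \<in> symcl R" if ij: "i < n" "j < n" for i j
  proof
    assume "f i \<rightarrow>\<^bsub>G\<^esub> f j"
    then obtain e where e: "e \<in> arcs G" "tail G e = f i" "head G e = f j"
      by (auto simp: arcs_ends_conv)
    then have "e \<in> arcs H" using f ij GH(4) by simp
    moreover from th[OF this] have "iso_arcs m e = (i, j)"
      using e f ij GH(1,2) T D by (simp add: prod_eq_iff)
    ultimately show "(i, j) \<in> symcl R" using A by (metis image_eqI)
  next
    assume "(i, j) \<in> symcl R"
    then obtain e where e: "e \<in> arcs H" "iso_arcs m e = (i, j)" using A by (metis imageE)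
    then have "iso_verts m (tail H e) = i" "iso_verts m (head H e) = j" using th T D by auto
    moreover have "tail H e \<in> verts H" "head H e \<in> verts H"
      using wf e(1) by (auto simp: wf_digraph_def)
    ultimately have "tail H e = f i" "head H e = f j"
      using inj by (auto simp: f_def the_inv_into_f_f)
    then show "f i \<rightarrow>\<^bsub>G\<^esub> f j" using e GH by (auto simp: arcs_ends_conv intro!: image_eqI[of _ _ e])
  qed
  moreover have "f ` {..<n} \<subseteq> verts G" using f GH(3) by auto
  ultimately show ?thesis using that by blast
qed

section \<open>Colorings as vertices of the reconfiguration graph\<close>

lemma proper_coloring_iff_colorings:
  fixes G :: "('a, 'b) pre_digraph"
  assumes "wf_digraph G"
  shows "proper_coloring (verts G) (\<lambda>x y. x \<rightarrow>\<^bsub>G\<^esub> y) l c \<longleftrightarrow> restrict c (verts G) \<in> colorings G l"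
proof -
  interpret wf_digraph G by fact
  show ?thesis
    unfolding proper_coloring_def colorings_def
    by (auto simp: image_subset_iff dest: adj_in_verts)
qed

lemma colorings_proper:
  assumes "wf_digraph G" "c \<in> colorings G l"
  shows "proper_coloring (verts G) (\<lambda>x y. x \<rightarrow>\<^bsub>G\<^esub> y) l c" "restrict c (verts G) = c"
proof -
  show "restrict c (verts G) = c"
    using assms(2) by (auto simp: colorings_def PiE_restrict)
  then show "proper_coloring (verts G) (\<lambda>x y. x \<rightarrow>\<^bsub>G\<^esub> y) l c"
    using proper_coloring_iff_colorings[OF assms(1)] assms(2) by simp
qed

lemma recolor_reach_reachable:
  fixes G :: "('a, 'b) pre_digraph"
  assumes G: "graph G"
    and c: "proper_coloring (verts G) (\<lambda>x y. x \<rightarrow>\<^bsub>G\<^esub> y) l c"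
    and r: "recolor_reach (verts G) (\<lambda>x y. x \<rightarrow>\<^bsub>G\<^esub> y) l c d"
  shows "restrict c (verts G) \<rightarrow>\<^sup>*\<^bsub>reconfiguration_graph l G\<^esub> restrict d (verts G)"
proof -
  interpret graph G by fact
  interpret R: graph "reconfiguration_graph l G" by (rule graph_reconfiguration_graph[OF G])
  have verts: "verts (reconfiguration_graph l G) = colorings G l"
    by (simp add: reconfiguration_graph_def)
  note iff = proper_coloring_iff_colorings[OF wf_digraph_axioms]
  show ?thesis using r
  proof (induction rule: rtranclp_induct)
    case base
    then show ?case using c iff verts by (metis R.reachable_refl)
  next
    case (step d e)
    obtain v k where e: "e = d(v := k)"
      and de: "restrict d (verts G) \<in> colorings G l" "restrict e (verts G) \<in> colorings G l"
      using step.hyps(2) iff by (auto simp: recolor_step_def)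
    show ?case
    \<comment> \<open>A step can be void after restriction: it may change a value outside the vertex
      set or repeat the old color.\<close>
    proof (cases "restrict d (verts G) = restrict e (verts G)")
      case True
      then show ?thesis using step.IH by simp
    next
      case False
      then have "v \<in> verts G" "d v \<noteq> k" by (auto simp: e restrict_def fun_eq_iff split: if_splits)
      then have "\<exists>!x. x \<in> verts G \<and> restrict d (verts G) x \<noteq> restrict e (verts G) x"
        by (auto simp: e split: if_splits)
      then have "restrict d (verts G) \<rightarrow>\<^bsub>reconfiguration_graph l G\<^esub> restrict e (verts G)"
        using de by (simp add: reconfiguration_graph_def)
      then show ?thesis using step.IH R.reachable_adj_trans by blast
    qed
  qed
qed

lemma colorings_mono: "l \<le> l' \<Longrightarrow> colorings G l \<subseteq> colorings G l'"
  by (fastforce simp: colorings_def)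

lemma colorings_chromatic_number:
  assumes "graph G"
  shows "colorings G (chromatic_number G) \<noteq> {}"
proof -
  interpret graph G by fact
  obtain f :: "'a \<Rightarrow> nat" where f: "inj_on f (verts G)" "f ` verts G = {0..<card (verts G)}"
    using ex_bij_betw_finite_nat[OF finite_verts] by (auto simp: bij_betw_def)
  \<comment> \<open>Giving all vertices different colors shows that the minimum is attained;
    \<open>Suc\<close> shifts the enumeration from 0 to colors starting at 1.\<close>
  have "proper_coloring (verts G) (\<lambda>x y. x \<rightarrow>\<^bsub>G\<^esub> y) (card (verts G)) (\<lambda>x. Suc (f x))"
    using f adj_not_same by (auto simp: proper_coloring_def image_subset_iff inj_on_def Suc_le_eq)
  then have "\<exists>l. colorings G l \<noteq> {}"
    using proper_coloring_iff_colorings[OF wf_digraph_axioms] by blast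
  then show ?thesis unfolding chromatic_number_def by (rule LeastI_ex)
qed

text \<open>The rim is an odd cycle and needs three colors; the hub needs a fourth.\<close>

lemma (in wheel_graph) proper_coloring_ge_4:
  assumes c: "proper_coloring V E l c"
  shows "4 \<le> l"
proof (rule ccontr)
  assume "\<not> 4 \<le> l"
  then have "c (h i) \<in> {1, 2, 3}" if "i \<in> ico_wheel" for i
    using proper_coloring_range[OF c rim_V[OF that]] by auto
  then have r: "c (h i) = 1 \<or> c (h i) = 2 \<or> c (h i) = 3" if "i \<in> ico_wheel" for i
    using that by blast
  have ne: "c (h i) \<noteq> c (h j)" if "i \<in> ico_wheel" "j \<in> ico_wheel" "ico_adj i j" for i j
    using proper_coloring_edge[OF c _ rim_V rim_V] wheel that by blast
  have "c (h A0) \<noteq> c (h A1)" "c (h A1) \<noteq> c (h A2)" "c (h A2) \<noteq> c (h A3)" "c (h A3) \<noteq> c (h A4)"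
    "c (h A4) \<noteq> c (h A0)" "c (h HU) \<noteq> c (h A0)" "c (h HU) \<noteq> c (h A1)" "c (h HU) \<noteq> c (h A2)"
    "c (h HU) \<noteq> c (h A3)" "c (h HU) \<noteq> c (h A4)"
    by (rule ne; simp add: ico_adj_def)+
  then show False
    using r[of A0] r[of A1] r[of A2] r[of A3] r[of A4] r[of HU]
    by simp (elim disjE; simp)
qed

lemma wheel_graph_exists:
  fixes G :: "('a, 'b) pre_digraph"
  assumes G: "graph G" and free: "free_of [two_K2, K4, H4] G" and W: "contains_induced G W5"
  shows "\<exists>h. wheel_graph (verts G) (\<lambda>x y. x \<rightarrow>\<^bsub>G\<^esub> y) h"
proof -
  interpret graph G by fact
  define E where "E x y \<longleftrightarrow> x \<rightarrow>\<^bsub>G\<^esub> y" for x y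
  have sym: "E x y \<longleftrightarrow> E y x" for x y
    unfolding E_def by (metis arcs_ends_symmetric[OF sym_arcs])
  have irr: "\<not> E x x" for x unfolding E_def by (metis adj_not_same)
  have EV: "x \<in> verts G" if "E x y" for x y using that unfolding E_def by (rule adj_in_verts(1))
  have induced: "contains_induced G (graph_on n R)"
    if "length xs = n" "distinct xs" "set xs \<subseteq> verts G" "R \<subseteq> {..<n} \<times> {..<n}"
      "\<forall>i<n. \<forall>j<n. E (xs ! i) (xs ! j) \<longleftrightarrow> (i, j) \<in> symcl R" for xs n R
    using that unfolding E_def
    by (intro contains_induced_graph_onI[OF G, of "\<lambda>i. xs ! i"])
      (auto simp: inj_on_def nth_eq_iff_index_eq)
  have two_K2: "E a c \<or> E a d \<or> E b c \<or> E b d" if ab: "E a b" and cd: "E c d" for a b c d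
  proof (rule ccontr)
    assume n: "\<not> ?thesis"
    then have n': "\<not> E a c" "\<not> E a d" "\<not> E b c" "\<not> E b d" "\<not> E c a" "\<not> E d a" "\<not> E c b" "\<not> E d b"
      using sym by blast+
    have e: "E a b" "E b a" "E c d" "E d c" using ab cd sym by blast+
    have "contains_induced G two_K2"
      unfolding two_K2_def
    proof (rule induced[of "[a, b, c, d]"])
      show "distinct [a, b, c, d]" using e n' irr by auto
      show "set [a, b, c, d] \<subseteq> verts G" using e EV by auto
      show "\<forall>i<4. \<forall>j<4. E ([a, b, c, d] ! i) ([a, b, c, d] ! j) \<longleftrightarrow> (i, j) \<in> symcl {(0, 1), (2, 3)}"
        using e n' irr by (simp add: numeral_eq_Suc All_less_Suc symcl_def)
    qed auto
    then show False using free by (simp add: free_of_def)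
  qed
  have K4: "\<not> E c d" if p: "E a b" "E a c" "E a d" "E b c" "E b d" for a b c d
  proof
    assume cd: "E c d"
    have e: "E b a" "E c a" "E d a" "E c b" "E d b" "E d c" using cd p sym by blast+
    have "contains_induced G K4"
      unfolding K4_def
    proof (rule induced[of "[a, b, c, d]"])
      show "distinct [a, b, c, d]" using p cd irr by auto
      show "set [a, b, c, d] \<subseteq> verts G" using p e EV by auto
      show "\<forall>i<4. \<forall>j<4. E ([a, b, c, d] ! i) ([a, b, c, d] ! j) \<longleftrightarrow>
          (i, j) \<in> symcl {(0, 1), (0, 2), (0, 3), (1, 2), (1, 3), (2, 3)}"
        using p e cd irr by (simp add: numeral_eq_Suc All_less_Suc symcl_def)
    qed auto
    then show False using free by (simp add: free_of_def)
  qed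
  have H4: "E x t" if C: "induced_C5 E p q r s t" and x: "E x p" "E x q" "E x r" "E x s" for p q r s t x
  proof (rule ccontr)
    assume n: "\<not> E x t"
    note c = C[unfolded induced_C5_def]
    have e: "E p q" "E q r" "E r s" "E s t" "E t p" "E q p" "E r q" "E s r" "E t s" "E p t"
      "E p x" "E q x" "E r x" "E s x" using c x sym by blast+
    have n': "\<not> E p r" "\<not> E q s" "\<not> E r t" "\<not> E s p" "\<not> E t q"
      "\<not> E r p" "\<not> E s q" "\<not> E t r" "\<not> E p s" "\<not> E q t" "\<not> E t x" "\<not> E x t"
      using c n sym by blast+
    have "contains_induced G H4"
      unfolding H4_def
    proof (rule induced[of "[p, q, r, s, t, x]"])
      show "distinct [p, q, r, s, t, x]" using e x n' irr by auto
      show "set [p, q, r, s, t, x] \<subseteq> verts G" using x e EV by auto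
      show "\<forall>i<6. \<forall>j<6. E ([p, q, r, s, t, x] ! i) ([p, q, r, s, t, x] ! j) \<longleftrightarrow>
          (i, j) \<in> symcl (cycle5_edges \<union> {(5, 0), (5, 1), (5, 2), (5, 3)})"
        using e x n' irr by (simp add: numeral_eq_Suc All_less_Suc symcl_def cycle5_edges_def)
    qed (auto simp: cycle5_edges_def)
    then show False using free by (simp add: free_of_def)
  qed
  obtain f where f: "\<And>i j. i < 6 \<Longrightarrow> j < 6 \<Longrightarrow> E (f i) (f j) \<longleftrightarrow>
      (i, j) \<in> symcl (cycle5_edges \<union> {(5, 0), (5, 1), (5, 2), (5, 3), (5, 4)})"
    using W unfolding W5_def E_def by (elim contains_induced_graph_onE) blast
  have f': "\<forall>i<6. \<forall>j<6. E (f i) (f j) \<longleftrightarrow>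
      (i, j) \<in> symcl (cycle5_edges \<union> {(5, 0), (5, 1), (5, 2), (5, 3), (5, 4)})"
    using f by blast
  \<comment> \<open>The wildcard case serves the hub \<open>HU\<close>; at the remaining indices
    \<open>f 5\<close> is a mere default value.\<close>
  define h where "h = (\<lambda>i. case i of A0 \<Rightarrow> f 0 | A1 \<Rightarrow> f 1 | A2 \<Rightarrow> f 2 | A3 \<Rightarrow> f 3 | A4 \<Rightarrow> f 4 | _ \<Rightarrow> f 5)"
  have "wheel_graph (verts G) E h"
  proof
    show "E (h i) (h j) \<longleftrightarrow> ico_adj i j" if "i \<in> ico_wheel" "j \<in> ico_wheel" for i j
      using that f' unfolding h_def
      by (cases i; cases j;
          simp add: ico_adj_def numeral_eq_Suc All_less_Suc symcl_def cycle5_edges_def)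
  qed (fact finite_verts sym irr EV two_K2 K4 H4)+
  then show ?thesis unfolding E_def by blast
qed

theorem theorem1p7:
  fixes G :: "('a, 'b) pre_digraph"
  assumes "graph G"
    and "free_of [two_K2, K4, H4] G"
    and "contains_induced G W5"
  shows "recolorable G"
  unfolding recolorable_def
proof (intro allI impI)
  fix l assume l: "chromatic_number G < l"
  interpret graph G by fact
  interpret R: graph "reconfiguration_graph l G"
    by (rule graph_reconfiguration_graph[OF assms(1)])
  obtain h where "wheel_graph (verts G) (\<lambda>x y. x \<rightarrow>\<^bsub>G\<^esub> y) h"
    using wheel_graph_exists[OF assms] by blast
  then interpret W: wheel_graph "verts G" "\<lambda>x y. x \<rightarrow>\<^bsub>G\<^esub> y" h .
  have ne: "colorings G (chromatic_number G) \<noteq> {}"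
    by (rule colorings_chromatic_number[OF assms(1)])
  then have "4 \<le> chromatic_number G"
    using colorings_proper(1)[OF wf_digraph_axioms] W.proper_coloring_ge_4 by blast
  with l have l5: "5 \<le> l" by simp
  have verts: "verts (reconfiguration_graph l G) = colorings G l"
    by (simp add: reconfiguration_graph_def)
  show "Digraph_Component.connected (reconfiguration_graph l G)"
    unfolding Digraph_Component.connected_def strongly_connected_def
  proof (intro conjI ballI)
    have "colorings G l \<noteq> {}" using ne colorings_mono[of "chromatic_number G" l G] l by auto
    then show "verts (mk_symmetric (reconfiguration_graph l G)) \<noteq> {}" by (simp add: verts)
    fix c d
    assume "c \<in> verts (mk_symmetric (reconfiguration_graph l G))"
      "d \<in> verts (mk_symmetric (reconfiguration_graph l G))"
    then have cd: "c \<in> colorings G l" "d \<in> colorings G l" by (simp_all add: verts)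
    note c = colorings_proper[OF wf_digraph_axioms cd(1)]
    note d = colorings_proper[OF wf_digraph_axioms cd(2)]
    obtain d' where d': "recolor_reach (verts G) (\<lambda>x y. x \<rightarrow>\<^bsub>G\<^esub> y) l c d'" "\<forall>x\<in>verts G. d' x = d x"
      using W.recolor_connected[OF l5 c(1) d(1)] by blast
    have "restrict d' (verts G) = d" using d'(2) d(2) by (metis restrict_ext)
    then have "c \<rightarrow>\<^sup>*\<^bsub>reconfiguration_graph l G\<^esub> d"
      using recolor_reach_reachable[OF assms(1) c(1) d'(1)] c(2) by simp
    then show "c \<rightarrow>\<^sup>*\<^bsub>mk_symmetric (reconfiguration_graph l G)\<^esub> d"
      by (rule R.reachable_mk_symmetricI)
  qed
qed

end
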